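(* Let $n\ge1$, let $\Theta\in M_n(\mathbb{R})$ be a skewsymmetric matrix in block normal form which satisfies the Diophantine condition (both described in the context), and let $g$ be a constant metric. Then for any $l,r\in C^\infty(\mathbb{T}^n_\Theta)$, $$\mathrm{Sp}\big(L(l)R(r)\big)=\sqrt g\sum_{q\in\mathcal{Z}}l_q\,r_{-q}.$$
   Context: Noncommutative torus. $C^\infty(\mathbb{T}^n_\Theta)$ is the $*$-algebra of all $a=(2\pi)^{-n/2}\sum_{k\in\mathbb{Z}^n}a_kU_k$ with $\{a_k\}$ a Schwartz (rapidly decreasing) sequence, where the $U_k$ are unitaries with $U_kU_q=e^{-\frac i2 k\cdot\Theta q}U_{k+q}$, $U_k^*=U_{-k}$ (here $k\cdot\Theta q=\sum_{\mu,\nu}k_\mu\Theta^{\mu\nu}q_\nu$). In the claim, $l_q$ and $r_q$ are the coefficients of $l$ and $r$ in this normalization. $\tau(a):=(2\pi)^{-n/2}a_0$, and $\mathcal{H}_\tau$ is the completion of $C^\infty(\mathbb{T}^n_\Theta)$ for $\langle a,b\rangle=\tau(a^*b)$, so $\{U_k\}$ is an orthonormal basis. $L(a)b=ab$ and $R(a)b=ba$ are the left and right regular representations on $\mathcal{H}_\tau$. $\delta_\mu(U_k)=ik_\mu U_k$. Metric, Laplacian, Sp. $g^{\mu\nu}$ is a constant positive definite symmetric matrix with inverse $g_{\mu\nu}$, $\sqrt g=\sqrt{\det(g_{\mu\nu})}$, and $\Delta:=-g^{\mu\nu}\delta_\mu\delta_\nu$, i.e. $\Delta U_k=g^{\mu\nu}k_\mu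 k_\nu U_k$. For a bounded operator $A$ on $\mathcal{H}_\tau$, $\mathrm{Sp}(A):=\lim_{t\to0^+}(4\pi t)^{n/2}\,\mathrm{Tr}(Ae^{-t\Delta})$ (the claim includes existence of the limit). Block normal form and Diophantine condition. $n=l_0+m_1+m_2$ and $$\Theta=0_{l_0}\ \oplus\bigoplus_{i:\,\theta_i\in2\pi\mathbb{Q}\setminus\{0\}}\theta_i\begin{pmatrix}0&1\\-1&0\end{pmatrix}\ \oplus\bigoplus_{j:\,\theta_j\in\mathbb{R}\setminus2\pi\mathbb{Q}}\theta_j\begin{pmatrix}0&1\\-1&0\end{pmatrix},$$ where $0_{l_0}$ is the zero matrix of size $l_0$, the rational part has total size $m_1$ and the irrational part has total size $m_2$. $\mathcal{Z}:=\{q\in\mathbb{Z}^n:(2\pi)^{-1}\Theta q\in\mathbb{Z}^n\}$. $\mathcal{K}^{\rm inf}$ is the set of nonzero $q\in\mathbb{Z}^n$ whose only nonzero coordinates are among the last $m_2$ ones (so $\mathcal{K}^{\rm inf}\simeq\mathbb{Z}^{m_2}\setminus\{0\}$). The Diophantine condition: there are constants $C>0$, $\beta>0$ such that $\inf_{k\in\mathbb{Z}^n}|\Theta q-2\pi k|\ge C|q|^{-(1+\beta)}$ for all $q\in\mathcal{K}^{\rm inf}$. *)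

theory Defs
  imports "HOL-Analysis.Analysis"
begin

abbreviation rvec :: "int ^ 'n \<Rightarrow> real ^ 'n" where
  "rvec k \<equiv> (\<chi> \<mu>. real_of_int (k $ \<mu>))"


section \<open>The noncommutative torus\<close>

text \<open>
  An element (or a vector of the GNS space) \<open>a = \<Sum>\<^sub>k a(k) U\<^sub>k\<close> is represented by the family
  \<open>k \<mapsto> a(k)\<close> of its coefficients with respect to the unitaries \<open>U\<^sub>k\<close>. The coefficients \<open>a\<^sub>k\<close> in
  the normalization \<open>a = (2\<pi>)\<^sup>-\<^sup>n\<^sup>/\<^sup>2 \<Sum>\<^sub>k a\<^sub>k U\<^sub>k\<close> are given by \<open>nct_coeff\<close>.
\<close>

type_synonym 'n nct = "int ^ 'n \<Rightarrow> complex"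

definition nct_U :: "int ^ 'n \<Rightarrow> 'n nct" where
  "nct_U k = (\<lambda>j. if j = k then 1 else 0)"

definition nct_coeff :: "'n::finite nct \<Rightarrow> int ^ 'n \<Rightarrow> complex" where
  "nct_coeff a k = of_real ((2 * pi) powr (real CARD('n) / 2)) * a k"

definition rapidly_decreasing :: "(int ^ 'n::finite \<Rightarrow> complex) \<Rightarrow> bool" where
  "rapidly_decreasing s \<longleftrightarrow> (\<forall>N::nat. \<exists>C. \<forall>k. (1 + norm (rvec k)) ^ N * cmod (s k) \<le> C)"

definition nct_smooth :: "'n::finite nct set" where
  "nct_smooth = {a. rapidly_decreasing (nct_coeff a)}"

definition nct_cocycle :: "real ^ 'n ^ 'n \<Rightarrow> int ^ 'n \<Rightarrow> int ^ 'n::finite \<Rightarrow> complex" where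
  "nct_cocycle \<Theta> k q = exp (- (\<i> / 2) * of_real (rvec k \<bullet> (\<Theta> *v rvec q)))"

text \<open>The bilinear extension of \<open>U\<^sub>p U\<^sub>q = nct_cocycle \<Theta> p q U\<^sub>p\<^sub>+\<^sub>q\<close>. The defining series converges
  absolutely for all square-summable \<open>a\<close>, \<open>b\<close>.\<close>

definition nct_mult :: "real ^ 'n ^ 'n \<Rightarrow> 'n nct \<Rightarrow> 'n nct \<Rightarrow> 'n::finite nct" where
  "nct_mult \<Theta> a b = (\<lambda>k. \<Sum>\<^sub>\<infinity>p. a p * b (k - p) * nct_cocycle \<Theta> p (k - p))"

definition nct_star :: "'n nct \<Rightarrow> 'n::finite nct" where
  "nct_star a = (\<lambda>k. cnj (a (- k)))"

definition nct_tau :: "'n::finite nct \<Rightarrow> complex" where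
  "nct_tau a = of_real ((2 * pi) powr (- real CARD('n) / 2)) * nct_coeff a 0"

definition nct_delta :: "'n \<Rightarrow> 'n nct \<Rightarrow> 'n::finite nct" where
  "nct_delta \<mu> a = (\<lambda>k. \<i> * of_int (k $ \<mu>) * a k)"


section \<open>The Hilbert space and its operators\<close>

text \<open>
  Since \<open>\<langle>a, b\<rangle> = \<tau>(a\<^sup>* b) = \<Sum>\<^sub>k cnj (a(k)) b(k)\<close> (see \<open>nct_tau_star_mult\<close> below), the completion of the
  smooth algebra is the space of square-summable families, with orthonormal basis \<open>U\<^sub>k\<close>.
  Operators are functions on families of which only the restriction to that space matters.
\<close>

definition H_tau :: "'n::finite nct set" where
  "H_tau = {\<xi>. (\<lambda>k. (cmod (\<xi> k))\<^sup>2) summable_on UNIV}"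

definition H_inner :: "'n nct \<Rightarrow> 'n::finite nct \<Rightarrow> complex" where
  "H_inner \<xi> \<eta> = (\<Sum>\<^sub>\<infinity>k. cnj (\<xi> k) * \<eta> k)"

definition H_norm :: "'n::finite nct \<Rightarrow> real" where
  "H_norm \<xi> = sqrt (\<Sum>\<^sub>\<infinity>k. (cmod (\<xi> k))\<^sup>2)"

definition bounded_op :: "('n nct \<Rightarrow> 'n::finite nct) \<Rightarrow> bool" where
  "bounded_op T \<longleftrightarrow>
     (\<forall>\<xi>\<in>H_tau. T \<xi> \<in> H_tau) \<and>
     (\<forall>\<xi>\<in>H_tau. \<forall>\<eta>\<in>H_tau. T (\<lambda>k. \<xi> k + \<eta> k) = (\<lambda>k. T \<xi> k + T \<eta> k)) \<and>
     (\<forall>c. \<forall>\<xi>\<in>H_tau. T (\<lambda>k. c * \<xi> k) = (\<lambda>k. c * T \<xi> k)) \<and>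
     (\<exists>C. \<forall>\<xi>\<in>H_tau. H_norm (T \<xi>) \<le> C * H_norm \<xi>)"

definition hilbert_schmidt :: "('n nct \<Rightarrow> 'n::finite nct) \<Rightarrow> bool" where
  "hilbert_schmidt T \<longleftrightarrow> bounded_op T \<and> (\<lambda>k. (H_norm (T (nct_U k)))\<^sup>2) summable_on UNIV"

text \<open>Trace-class operators are the products of two Hilbert--Schmidt operators.\<close>

definition trace_class :: "('n nct \<Rightarrow> 'n::finite nct) \<Rightarrow> bool" where
  "trace_class T \<longleftrightarrow>
     (\<exists>A B. hilbert_schmidt A \<and> hilbert_schmidt B \<and> (\<forall>\<xi>\<in>H_tau. T \<xi> = A (B \<xi>)))"

definition op_trace :: "('n nct \<Rightarrow> 'n::finite nct) \<Rightarrow> complex" where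
  "op_trace T = (\<Sum>\<^sub>\<infinity>k. H_inner (nct_U k) (T (nct_U k)))"

text \<open>The regular representations: the series \<open>nct_mult\<close> with one factor in \<open>H_tau\<close> is the
  continuous extension of the product of the smooth algebra.\<close>

definition L_rep :: "real ^ 'n ^ 'n \<Rightarrow> 'n nct \<Rightarrow> 'n nct \<Rightarrow> 'n::finite nct" where
  "L_rep \<Theta> a \<xi> = nct_mult \<Theta> a \<xi>"

definition R_rep :: "real ^ 'n ^ 'n \<Rightarrow> 'n nct \<Rightarrow> 'n nct \<Rightarrow> 'n::finite nct" where
  "R_rep \<Theta> a \<xi> = nct_mult \<Theta> \<xi> a"


section \<open>Metric, Laplacian and the functional Sp\<close>

text \<open>Throughout, \<open>gi\<close> is the matrix \<open>g\<^sup>\<mu>\<^sup>\<nu>\<close> with upper indices.\<close>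

definition constant_metric :: "real ^ 'n ^ 'n::finite \<Rightarrow> bool" where
  "constant_metric gi \<longleftrightarrow> transpose gi = gi \<and> (\<forall>x. x \<noteq> 0 \<longrightarrow> x \<bullet> (gi *v x) > 0)"

definition sqrt_g :: "real ^ 'n ^ 'n::finite \<Rightarrow> real" where
  "sqrt_g gi = sqrt (det (matrix_inv gi))"

definition laplacian :: "real ^ 'n ^ 'n \<Rightarrow> 'n nct \<Rightarrow> 'n::finite nct" where
  "laplacian gi a =
     (\<lambda>k. - (\<Sum>\<mu>\<in>UNIV. \<Sum>\<nu>\<in>UNIV. of_real (gi $ \<mu> $ \<nu>) * nct_delta \<mu> (nct_delta \<nu> a) k))"

definition laplacian_eigenvalue :: "real ^ 'n ^ 'n \<Rightarrow> int ^ 'n::finite \<Rightarrow> real" where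
  "laplacian_eigenvalue gi k =
     (\<Sum>\<mu>\<in>UNIV. \<Sum>\<nu>\<in>UNIV. gi $ \<mu> $ \<nu> * of_int (k $ \<mu>) * of_int (k $ \<nu>))"

text \<open>\<open>e\<^sup>-\<^sup>t\<^sup>\<Delta>\<close>, by functional calculus in the eigenbasis \<open>U\<^sub>k\<close> (see \<open>laplacian_U\<close> below).\<close>

definition heat_op :: "real ^ 'n ^ 'n \<Rightarrow> real \<Rightarrow> 'n nct \<Rightarrow> 'n::finite nct" where
  "heat_op gi t \<xi> = (\<lambda>k. of_real (exp (- t * laplacian_eigenvalue gi k)) * \<xi> k)"

text \<open>\<open>has_Sp gi A s\<close> means that \<open>Sp(A)\<close> exists and equals \<open>s\<close>.\<close>

definition has_Sp :: "real ^ 'n ^ 'n \<Rightarrow> ('n nct \<Rightarrow> 'n::finite nct) \<Rightarrow> complex \<Rightarrow> bool" where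
  "has_Sp gi A s \<longleftrightarrow>
     bounded_op A \<and>
     (\<forall>t>0. trace_class (A \<circ> heat_op gi t)) \<and>
     ((\<lambda>t. of_real ((4 * pi * t) powr (real CARD('n) / 2)) * op_trace (A \<circ> heat_op gi t))
        \<longlongrightarrow> s) (at_right 0)"


section \<open>Block normal form and Diophantine condition\<close>

text \<open>
  The type \<open>'n\<close> of indices carries no order, so the order of the coordinates is given by an
  enumeration \<open>e 0, \<dots>, e (n - 1)\<close>. The lists \<open>rs\<close> and \<open>irs\<close> hold the parameters \<open>\<theta>\<^sub>i\<close> of the
  rational and of the irrational blocks, so that \<open>m\<^sub>1 = 2 * length rs\<close> and
  \<open>m\<^sub>2 = 2 * length irs\<close>.
\<close>

definition block_entry :: "nat \<Rightarrow> real list \<Rightarrow> nat \<Rightarrow> nat \<Rightarrow> real" where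
  "block_entry l\<^sub>0 \<theta>s i j =
     (if i < l\<^sub>0 \<or> j < l\<^sub>0 \<or> (i - l\<^sub>0) div 2 \<noteq> (j - l\<^sub>0) div 2 then 0
      else if j = i + 1 then \<theta>s ! ((i - l\<^sub>0) div 2)
      else if i = j + 1 then - (\<theta>s ! ((i - l\<^sub>0) div 2))
      else 0)"

definition block_normal_form ::
  "(nat \<Rightarrow> 'n) \<Rightarrow> nat \<Rightarrow> real list \<Rightarrow> real list \<Rightarrow> real ^ 'n ^ 'n::finite \<Rightarrow> bool" where
  "block_normal_form e l\<^sub>0 rs irs \<Theta> \<longleftrightarrow>
     bij_betw e {..<CARD('n)} UNIV \<and>
     CARD('n) = l\<^sub>0 + 2 * length rs + 2 * length irs \<and>
     (\<forall>\<theta>\<in>set rs. \<theta> \<noteq> 0 \<and> \<theta> / (2 * pi) \<in> \<rat>) \<and>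
     (\<forall>\<theta>\<in>set irs. \<theta> / (2 * pi) \<notin> \<rat>) \<and>
     (\<forall>i<CARD('n). \<forall>j<CARD('n). \<Theta> $ e i $ e j = block_entry l\<^sub>0 (rs @ irs) i j)"

definition K_inf :: "(nat \<Rightarrow> 'n) \<Rightarrow> nat \<Rightarrow> (int ^ 'n::finite) set" where
  "K_inf e m\<^sub>2 = {q. q \<noteq> 0 \<and> (\<forall>i<CARD('n) - m\<^sub>2. q $ e i = 0)}"

definition diophantine :: "(nat \<Rightarrow> 'n) \<Rightarrow> nat \<Rightarrow> real ^ 'n ^ 'n::finite \<Rightarrow> bool" where
  "diophantine e m\<^sub>2 \<Theta> \<longleftrightarrow>
     (\<exists>C>0. \<exists>\<beta>>0. \<forall>q\<in>K_inf e m\<^sub>2.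
        (INF k. norm (\<Theta> *v rvec q - (2 * pi) *\<^sub>R rvec k)) \<ge> C * norm (rvec q) powr (- (1 + \<beta>)))"

definition Z_set :: "real ^ 'n ^ 'n \<Rightarrow> (int ^ 'n::finite) set" where
  "Z_set \<Theta> = {q. \<exists>k. (1 / (2 * pi)) *\<^sub>R (\<Theta> *v rvec q) = rvec k}"


section \<open>Consistency of the definitions\<close>

lemma skew_form_self:
  fixes \<Theta> :: "real ^ 'n ^ 'n::finite"
  assumes "transpose \<Theta> = - \<Theta>"
  shows "x \<bullet> (\<Theta> *v x) = 0"
proof -
  have "x \<bullet> (\<Theta> *v x) = (transpose \<Theta> *v x) \<bullet> x"
    by (simp add: dot_lmul_matrix transpose_matrix_vector)
  also have "\<dots> = - (x \<bullet> (\<Theta> *v x))"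
    unfolding assms
    by (simp add: inner_vec_def matrix_vector_mult_def sum_negf mult.commute)
  finally show ?thesis by simp
qed

lemma nct_U_mult:
  "nct_mult \<Theta> (nct_U k) (nct_U q) = (\<lambda>j. nct_cocycle \<Theta> k q * nct_U (k + q) j)"
proof
  fix j
  have "nct_mult \<Theta> (nct_U k) (nct_U q) j =
      (\<Sum>\<^sub>\<infinity>p\<in>{k}. nct_U k p * nct_U q (j - p) * nct_cocycle \<Theta> p (j - p))"
    unfolding nct_mult_def by (rule infsum_cong_neutral) (auto simp: nct_U_def)
  then show "nct_mult \<Theta> (nct_U k) (nct_U q) j = nct_cocycle \<Theta> k q * nct_U (k + q) j"
    by (auto simp: nct_U_def algebra_simps)
qed

lemma nct_U_star: "nct_star (nct_U k) = nct_U (- k)"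
  by (auto simp: nct_star_def nct_U_def fun_eq_iff)

lemma nct_tau_star_mult:
  fixes \<Theta> :: "real ^ 'n ^ 'n::finite"
  assumes "transpose \<Theta> = - \<Theta>"
  shows "nct_tau (nct_mult \<Theta> (nct_star a) b) = H_inner a b"
proof -
  have tau: "nct_tau c = c 0" for c :: "'n nct"
    by (simp add: nct_tau_def nct_coeff_def powr_minus flip: of_real_mult)
  have c1: "nct_cocycle \<Theta> p (- p) = 1" for p
  proof -
    have "rvec (- p) = - rvec p" by (simp add: vec_eq_iff)
    moreover have "\<Theta> *v (- rvec p) = - (\<Theta> *v rvec p)"
      by (metis matrix_vector_mult_scaleR scaleR_minus1_left)
    ultimately show ?thesis
      by (simp add: nct_cocycle_def skew_form_self[OF assms])
  qed
  have "nct_tau (nct_mult \<Theta> (nct_star a) b) = (\<Sum>\<^sub>\<infinity>p. cnj (a (- p)) * b (- p))"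
    by (simp add: tau nct_mult_def nct_star_def c1)
  also have "\<dots> = H_inner a b"
    unfolding H_inner_def
    by (rule infsum_reindex_bij_betw) (auto intro!: bij_betwI[where g = uminus])
  finally show ?thesis .
qed

lemma laplacian_U:
  "laplacian gi (nct_U k) = (\<lambda>j. of_real (laplacian_eigenvalue gi k) * nct_U k j)"
  by (auto simp: laplacian_def laplacian_eigenvalue_def nct_delta_def nct_U_def fun_eq_iff
      algebra_simps simp flip: sum_negf)

end

theory Submission
  imports Defs "HOL-Probability.Distributions"
begin

text \<open>
  The diagonal entry of \<open>L(l) R(r)\<close> at \<open>U\<^sub>k\<close> is \<open>\<Sum>\<^sub>p l(p) r(-p) exp (\<i> k \<sqdot> \<Theta> p)\<close>, since the two
  cocycles combine to a character of the lattice. Hence \<open>(4\<pi>t)\<^sup>n\<^sup>/\<^sup>2 Tr(L(l) R(r) e\<^sup>-\<^sup>t\<^sup>\<Delta>)\<close> equals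
  \<open>\<Sum>\<^sub>p l(p) r(-p) S\<^sub>t(p)\<close>, where \<open>S\<^sub>t(p)\<close> is a normalized Gaussian lattice sum twisted by the
  character with frequency \<open>\<Theta> p\<close>. For \<open>p \<in> Z\<^sub>\<Theta>\<close> the character is trivial and \<open>S\<^sub>t(p)\<close> is a Riemann sum
  of a Gaussian integral, with limit \<open>(2\<pi>)\<^sup>n \<surd>g\<close>; for \<open>p \<notin> Z\<^sub>\<Theta>\<close> summation by parts shows
  \<open>S\<^sub>t(p) \<rightarrow> 0\<close>. As \<open>|S\<^sub>t(p)| \<le> S\<^sub>t(0)\<close> is bounded and \<open>p \<mapsto> l(p) r(-p)\<close> is summable, dominated
  convergence gives the limit of the sum.
\<close>


section \<open>Infinite sums\<close>

text \<open>How fast S_t(p) decays depends on the distance of \<open>\<Theta> p\<close> from 2 pi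
  Z^n, and these distances can accumulate at 0 as p varies. The limits are therefore taken pointwise
  in p and combined with a majorant from which the phase has disappeared. Both pointwise limits rest
  on one exact identity. With s = sqrt t, the factor t^(n/2) = s^n is the volume of a cell of the
  lattice s Z^n, so s^n times the sum of h over Z^n is the Lebesgue integral of the step function x
  -> h(floor(x/s)). Dominated convergence on R^n then takes the place of error estimates for Riemann
  sums and of Poisson summation. The Gaussian integral contributes sqrt g pi^(n/2), where sqrt g is
  the Jacobian of a frame orthonormal for the quadratic form. The heat normalization (4 pi)^(n/2)
  turns pi^(n/2) into (2 pi)^n, which is absorbed by the normalizations (2 pi)^(n/2) of the
  coefficients of l and of r.\<close>

lemma
  fixes f g :: "'a \<Rightarrow> 'b::real_normed_vector"
  assumes "f summable_on A" "g summable_on A"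
  shows summable_on_diff: "(\<lambda>x. f x - g x) summable_on A"
    and infsum_diff: "(\<Sum>\<^sub>\<infinity>x\<in>A. f x - g x) = infsum f A - infsum g A"
  using summable_on_add[OF assms(1) summable_on_uminus[THEN iffD2, OF assms(2)]]
    infsum_add[OF assms(1) summable_on_uminus[THEN iffD2, OF assms(2)]]
  by (simp_all add: infsum_uminus)

text \<open>Domination makes the finite partial sums converge uniformly in t on the set
  \<open>Y\<close> where the bound holds (Weierstrass M-test), so the limit along \<open>F\<close>
  and the limit over finite subsets can be interchanged. The filter is arbitrary because the
  application is to t -> 0+.\<close>

lemma tendsto_infsum_dominated:
  fixes f :: "'b \<Rightarrow> 'a \<Rightarrow> 'c::banach"
  assumes lim: "\<And>k. k \<in> A \<Longrightarrow> ((\<lambda>t. f t k) \<longlongrightarrow> g k) F"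
    and M: "M summable_on A"
    and bound: "eventually (\<lambda>t. \<forall>k\<in>A. norm (f t k) \<le> M k) F"
  shows "((\<lambda>t. infsum (f t) A) \<longlongrightarrow> infsum g A) F"
proof (cases "F = bot")
  case False
  define Y where "Y = {t. \<forall>k\<in>A. norm (f t k) \<le> M k}"
  \<comment> \<open>The limit function inherits the majorant, which makes \<open>g\<close> summable;
    this needs \<open>F\<close> to be nontrivial.\<close>
  have g: "norm (g k) \<le> M k" if "k \<in> A" for k
    by (rule tendsto_upperbound[OF tendsto_norm[OF lim[OF that]]])
      (use bound that False in \<open>auto elim: eventually_mono\<close>)
  have ul: "uniform_limit Y (\<lambda>X t. \<Sum>k\<in>X. f t k) (\<lambda>t. infsum (f t) A) (finite_subsets_at_top A)"
    by (rule Weierstrass_m_test_general[OF _ M]) (auto simp: Y_def)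
  have "(\<lambda>k. norm (g k)) summable_on A"
    by (rule summable_on_comparison_test[OF M]) (use g in auto)
  then have gs: "g summable_on A"
    by (rule abs_summable_summable)
  show ?thesis
  proof (rule swap_uniform_limit'[where f = "\<lambda>X t. \<Sum>k\<in>X. f t k" and F = "finite_subsets_at_top A"
        and g = "sum g" and S = Y])
    show "\<forall>\<^sub>F X in finite_subsets_at_top A. ((\<lambda>t. \<Sum>k\<in>X. f t k) \<longlongrightarrow> sum g X) F"
      by (rule eventually_finite_subsets_at_top_weakI) (auto intro!: tendsto_sum lim)
    show "(sum g \<longlongrightarrow> infsum g A) (finite_subsets_at_top A)"
      using gs by (rule infsum_tendsto)
    show "\<forall>\<^sub>F t in F. t \<in> Y"
      using bound by (simp add: Y_def)
  qed (use ul False in auto)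
qed simp

text \<open>The finite inequality bounds all partial sums by one constant; since the products are
  nonnegative, this yields summability together with the estimate.\<close>

lemma infsum_Cauchy_Schwarz:
  fixes x y :: "'a \<Rightarrow> real"
  assumes "(\<lambda>i. (x i)\<^sup>2) summable_on A" and "(\<lambda>i. (y i)\<^sup>2) summable_on A"
    and "\<And>i. i \<in> A \<Longrightarrow> 0 \<le> x i * y i"
  shows "(\<lambda>i. x i * y i) summable_on A"
    and "(\<Sum>\<^sub>\<infinity>i\<in>A. x i * y i)\<^sup>2 \<le> (\<Sum>\<^sub>\<infinity>i\<in>A. (x i)\<^sup>2) * (\<Sum>\<^sub>\<infinity>i\<in>A. (y i)\<^sup>2)"
proof -
  let ?X = "\<Sum>\<^sub>\<infinity>i\<in>A. (x i)\<^sup>2" and ?Y = "\<Sum>\<^sub>\<infinity>i\<in>A. (y i)\<^sup>2"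
  have fin: "(\<Sum>i\<in>F. x i * y i) \<le> sqrt (?X * ?Y)" if "finite F" "F \<subseteq> A" for F
  proof (rule real_le_rsqrt)
    have "(\<Sum>i\<in>F. x i * y i)\<^sup>2 \<le> (\<Sum>i\<in>F. (x i)\<^sup>2) * (\<Sum>i\<in>F. (y i)\<^sup>2)"
      by (rule Cauchy_Schwarz_ineq_sum)
    also have "\<dots> \<le> ?X * ?Y"
      by (intro mult_mono finite_sum_le_infsum assms that) (auto intro: sum_nonneg infsum_nonneg)
    finally show "(\<Sum>i\<in>F. x i * y i)\<^sup>2 \<le> ?X * ?Y" .
  qed
  show s: "(\<lambda>i. x i * y i) summable_on A"
    by (rule nonneg_bdd_above_summable_on) (use assms(3) fin in \<open>auto intro!: bdd_aboveI\<close>)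
  have "(\<Sum>\<^sub>\<infinity>i\<in>A. x i * y i) \<le> sqrt (?X * ?Y)"
    by (rule infsum_le_finite_sums[OF s]) (use fin in auto)
  moreover have "0 \<le> (\<Sum>\<^sub>\<infinity>i\<in>A. x i * y i)"
    by (rule infsum_nonneg) (use assms(3) in auto)
  moreover have "0 \<le> ?X * ?Y"
    by (intro mult_nonneg_nonneg infsum_nonneg) auto
  ultimately show "(\<Sum>\<^sub>\<infinity>i\<in>A. x i * y i)\<^sup>2 \<le> ?X * ?Y"
    by (metis power_mono real_sqrt_pow2)
qed

text \<open>Tonelli on pairs (p, k): summing over k first gives f(p) times the total of
  \<open>g\<close>, because translation permutes the group. The other order of summation is the
  convolution.\<close>

lemma has_sum_convolution:
  fixes f g :: "'a::ab_group_add \<Rightarrow> real"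
  assumes f: "f summable_on UNIV" "\<And>p. 0 \<le> f p" and g: "g summable_on UNIV" "\<And>k. 0 \<le> g k"
  shows "(\<lambda>p. f p * g (k - p)) summable_on UNIV"
    and "((\<lambda>k. \<Sum>\<^sub>\<infinity>p. f p * g (k - p)) has_sum (infsum f UNIV * infsum g UNIV)) UNIV"
proof -
  define h where "h = (\<lambda>(p, k). f p * g (k - p))"
  have bij: "bij_betw (\<lambda>k. k - p) UNIV UNIV" for p :: 'a
    by (rule bij_betwI[where g = "\<lambda>k. k + p"]) auto
  have inner: "((\<lambda>k. f p * g (k - p)) has_sum (f p * infsum g UNIV)) UNIV" for p
    using g has_sum_reindex_bij_betw[OF bij, of g p "infsum g UNIV"]
    by (intro has_sum_cmult_right) simp
  have "(h has_sum (infsum f UNIV * infsum g UNIV)) (Sigma UNIV (\<lambda>_. UNIV))"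
  proof (rule has_sum_SigmaI)
    show "((\<lambda>y. h (x, y)) has_sum (f x * infsum g UNIV)) UNIV" for x
      using inner by (simp add: h_def)
    show "((\<lambda>x. f x * infsum g UNIV) has_sum (infsum f UNIV * infsum g UNIV)) UNIV"
      using f by (intro has_sum_cmult_left) auto
    show "h summable_on Sigma UNIV (\<lambda>_. UNIV)"
    proof (rule summable_on_SigmaI)
      show "((\<lambda>y. h (x, y)) has_sum (f x * infsum g UNIV)) UNIV" for x
        using inner by (simp add: h_def)
      show "(\<lambda>x. f x * infsum g UNIV) summable_on UNIV"
        using f by (intro summable_on_cmult_left) auto
    qed (use f g in \<open>auto simp: h_def\<close>)
  qed
  then have sw: "((\<lambda>(k, p). f p * g (k - p)) has_sum (infsum f UNIV * infsum g UNIV)) (UNIV \<times> UNIV)"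
    by (subst has_sum_swap) (simp add: h_def)
  have s: "(\<lambda>p. f p * g (k - p)) summable_on UNIV" for k
    using summable_on_SigmaD1[OF has_sum_imp_summable[OF sw], of k] by simp
  then show "(\<lambda>p. f p * g (k - p)) summable_on UNIV" .
  show "((\<lambda>k. \<Sum>\<^sub>\<infinity>p. f p * g (k - p)) has_sum (infsum f UNIV * infsum g UNIV)) UNIV"
    using has_sum_SigmaD[OF sw, of "\<lambda>k. \<Sum>\<^sub>\<infinity>p. f p * g (k - p)"] s by simp
qed


section \<open>Operators on the Hilbert space\<close>

lemma H_norm_nonneg: "0 \<le> H_norm \<xi>"
  unfolding H_norm_def by (intro real_sqrt_ge_zero infsum_nonneg) auto

lemma H_norm_power2: "(H_norm \<xi>)\<^sup>2 = (\<Sum>\<^sub>\<infinity>k. (cmod (\<xi> k))\<^sup>2)"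
  unfolding H_norm_def by (intro real_sqrt_pow2 infsum_nonneg) auto

lemma H_norm_scale: "H_norm (\<lambda>j. c * \<xi> j) = cmod c * H_norm \<xi>"
  by (simp add: H_norm_def norm_mult power_mult_distrib infsum_cmult_right' real_sqrt_mult)

lemma nct_U_in_H_tau: "nct_U k \<in> H_tau"
proof -
  have "(\<lambda>j. (cmod (nct_U k j))\<^sup>2) summable_on UNIV \<longleftrightarrow> (\<lambda>j. (cmod (nct_U k j))\<^sup>2) summable_on {k}"
    by (rule summable_on_cong_neutral) (auto simp: nct_U_def)
  then show ?thesis by (simp add: H_tau_def)
qed

lemma H_norm_nct_U: "H_norm (nct_U k) = 1"
proof -
  have "(\<Sum>\<^sub>\<infinity>j. (cmod (nct_U k j))\<^sup>2) = (\<Sum>\<^sub>\<infinity>j\<in>{k}. (cmod (nct_U k j))\<^sup>2)"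
    by (rule infsum_cong_neutral) (auto simp: nct_U_def)
  then show ?thesis by (simp add: H_norm_def nct_U_def)
qed

lemma H_inner_nct_U: "H_inner (nct_U k) \<xi> = \<xi> k"
proof -
  have "H_inner (nct_U k) \<xi> = (\<Sum>\<^sub>\<infinity>j\<in>{k}. cnj (nct_U k j) * \<xi> j)"
    unfolding H_inner_def by (rule infsum_cong_neutral) (auto simp: nct_U_def)
  then show ?thesis by (simp add: nct_U_def)
qed

lemma bounded_op_comp:
  assumes S: "bounded_op S" and T: "bounded_op T"
  shows "bounded_op (S \<circ> T)"
proof -
  obtain C where C: "\<And>\<xi>. \<xi> \<in> H_tau \<Longrightarrow> H_norm (S \<xi>) \<le> C * H_norm \<xi>"
    using S unfolding bounded_op_def by blast
  obtain D where D: "\<And>\<xi>. \<xi> \<in> H_tau \<Longrightarrow> H_norm (T \<xi>) \<le> D * H_norm \<xi>"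
    using T unfolding bounded_op_def by blast
  have mem: "T \<xi> \<in> H_tau" if "\<xi> \<in> H_tau" for \<xi>
    using T that by (auto simp: bounded_op_def)
  have "H_norm (S (T \<xi>)) \<le> (\<bar>C\<bar> * D) * H_norm \<xi>" if "\<xi> \<in> H_tau" for \<xi>
  proof -
    have "H_norm (S (T \<xi>)) \<le> C * H_norm (T \<xi>)"
      using C mem that by blast
    also have "\<dots> \<le> \<bar>C\<bar> * H_norm (T \<xi>)"
      by (intro mult_right_mono) (auto simp: H_norm_nonneg)
    also have "\<dots> \<le> \<bar>C\<bar> * (D * H_norm \<xi>)"
      by (intro mult_left_mono D that) auto
    finally show ?thesis by (simp add: mult.assoc)
  qed
  then show ?thesis
    using S T unfolding bounded_op_def comp_def by auto
qed

lemma bounded_op_cong: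
  assumes "bounded_op S" and "\<And>\<xi>. S \<xi> = T \<xi>"
  shows "bounded_op T"
  using assms by (metis ext)

text \<open>Schur test, or Young's inequality for l1 acting on l2, with the l1 norm of
  \<open>a\<close> as operator bound. The phases \<open>c\<close> enter only through their modulus,
  so left and right multiplication are both instances.\<close>

lemma bounded_op_twisted_convolution:
  fixes a :: "'n::finite nct" and c :: "int ^ 'n \<Rightarrow> int ^ 'n \<Rightarrow> complex"
  assumes a: "(\<lambda>p. cmod (a p)) summable_on UNIV" and c: "\<And>p k. cmod (c p k) \<le> 1"
  shows "bounded_op (\<lambda>\<xi> k. \<Sum>\<^sub>\<infinity>p. a p * c p k * \<xi> (k - p))"
proof -
  define A where "A = (\<Sum>\<^sub>\<infinity>p. cmod (a p))"
  have A: "0 \<le> A"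
    unfolding A_def by (rule infsum_nonneg) auto
  let ?T = "\<lambda>\<xi> k. \<Sum>\<^sub>\<infinity>p. a p * c p k * \<xi> (k - p)"
  let ?q = "\<lambda>\<xi> k p. cmod (a p) * (cmod (\<xi> (k - p)))\<^sup>2"
  have "(\<lambda>p. cmod (a p * c p k * \<xi> (k - p))) summable_on UNIV \<and>
      (\<Sum>\<^sub>\<infinity>p. cmod (a p * c p k * \<xi> (k - p)))\<^sup>2 \<le> A * (\<Sum>\<^sub>\<infinity>p. ?q \<xi> k p)" if \<xi>: "\<xi> \<in> H_tau" for \<xi> :: "'n nct" and k
  proof -
    \<comment> \<open>Half of the weight |a| goes to each factor, so that Cauchy-Schwarz leaves |a|
      |xi|^2, again a convolution of nonnegative summable families.\<close>
    let ?x = "\<lambda>p. sqrt (cmod (a p))" and ?y = "\<lambda>p. sqrt (cmod (a p)) * cmod (\<xi> (k - p))"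
    have "(\<lambda>p. ?q \<xi> k p) summable_on UNIV"
      using \<xi> by (intro has_sum_convolution(1) a) (auto simp: H_tau_def)
    then have y: "(\<lambda>p. (?y p)\<^sup>2) summable_on UNIV"
      by (simp add: power_mult_distrib)
    have x: "(\<lambda>p. (?x p)\<^sup>2) summable_on UNIV"
      using a by simp
    have nn: "0 \<le> ?x p * ?y p" for p by simp
    have xy: "?x p * ?y p = cmod (a p) * cmod (\<xi> (k - p))" for p
      by (simp flip: mult.assoc)
    note cs = infsum_Cauchy_Schwarz[OF x y nn, unfolded xy]
    have le: "cmod (a p * c p k * \<xi> (k - p)) \<le> cmod (a p) * cmod (\<xi> (k - p))" for p
      using mult_mono[OF mult_left_mono[OF c[of p k], of "cmod (a p)"], of "cmod (\<xi> (k - p))"]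
      by (simp add: norm_mult)
    have s: "(\<lambda>p. cmod (a p * c p k * \<xi> (k - p))) summable_on UNIV"
      by (rule summable_on_comparison_test[OF cs(1) le]) auto
    have "(\<Sum>\<^sub>\<infinity>p. cmod (a p * c p k * \<xi> (k - p))) \<le> (\<Sum>\<^sub>\<infinity>p. cmod (a p) * cmod (\<xi> (k - p)))"
      by (rule infsum_mono[OF s cs(1) le])
    then have "(\<Sum>\<^sub>\<infinity>p. cmod (a p * c p k * \<xi> (k - p)))\<^sup>2 \<le> (\<Sum>\<^sub>\<infinity>p. cmod (a p) * cmod (\<xi> (k - p)))\<^sup>2"
      by (intro power_mono infsum_nonneg) auto
    also have "\<dots> \<le> A * (\<Sum>\<^sub>\<infinity>p. ?q \<xi> k p)"
      using cs(2) by (simp add: power_mult_distrib A_def)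
    finally show ?thesis using s by blast
  qed
  then have sq: "(\<lambda>p. cmod (a p * c p k * \<xi> (k - p))) summable_on UNIV"
      "(\<Sum>\<^sub>\<infinity>p. cmod (a p * c p k * \<xi> (k - p)))\<^sup>2 \<le> A * (\<Sum>\<^sub>\<infinity>p. ?q \<xi> k p)"
    if "\<xi> \<in> H_tau" for \<xi> :: "'n nct" and k using that by auto
  have sm: "(\<lambda>p. a p * c p k * \<xi> (k - p)) summable_on UNIV" if "\<xi> \<in> H_tau" for \<xi> k
    using sq(1)[OF that] by (rule abs_summable_summable)
  have nt: "(cmod (?T \<xi> k))\<^sup>2 \<le> A * (\<Sum>\<^sub>\<infinity>p. ?q \<xi> k p)" if "\<xi> \<in> H_tau" for \<xi> k
  proof -
    have "(cmod (?T \<xi> k))\<^sup>2 \<le> (\<Sum>\<^sub>\<infinity>p. cmod (a p * c p k * \<xi> (k - p)))\<^sup>2"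
      by (intro power_mono norm_infsum_bound sq(1)[OF that]) auto
    then show ?thesis using sq(2)[OF that, of k] by linarith
  qed
  \<comment> \<open>One factor \<open>A\<close> comes from Cauchy-Schwarz, the other from summing
    the convolution over k.\<close>
  have tot: "((\<lambda>k. A * (\<Sum>\<^sub>\<infinity>p. ?q \<xi> k p)) has_sum (A * (A * (H_norm \<xi>)\<^sup>2))) UNIV" if "\<xi> \<in> H_tau" for \<xi>
    unfolding A_def H_norm_power2
    using that by (intro has_sum_cmult_right has_sum_convolution(2) a) (auto simp: H_tau_def)
  have TH: "?T \<xi> \<in> H_tau" if "\<xi> \<in> H_tau" for \<xi>
    unfolding H_tau_def mem_Collect_eq
    by (rule summable_on_comparison_test[OF has_sum_imp_summable[OF tot[OF that]] nt[OF that]]) auto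
  have "H_norm (?T \<xi>) \<le> A * H_norm \<xi>" if "\<xi> \<in> H_tau" for \<xi>
  proof (rule power2_le_imp_le)
    have "(H_norm (?T \<xi>))\<^sup>2 \<le> (\<Sum>\<^sub>\<infinity>k. A * (\<Sum>\<^sub>\<infinity>p. ?q \<xi> k p))"
      unfolding H_norm_power2 using TH[OF that] tot[OF that] nt[OF that]
      by (intro infsum_mono) (auto simp: H_tau_def dest: has_sum_imp_summable)
    also have "\<dots> = (A * H_norm \<xi>)\<^sup>2"
      using infsumI[OF tot[OF that]] by (simp add: power2_eq_square)
    finally show "(H_norm (?T \<xi>))\<^sup>2 \<le> (A * H_norm \<xi>)\<^sup>2" .
  qed (use A in \<open>auto simp: H_norm_nonneg\<close>)
  moreover have "?T (\<lambda>k. \<xi> k + \<eta> k) = (\<lambda>k. ?T \<xi> k + ?T \<eta> k)" if "\<xi> \<in> H_tau" "\<eta> \<in> H_tau" for \<xi> \<eta>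
    using sm[OF that(1)] sm[OF that(2)] by (simp add: fun_eq_iff distrib_left infsum_add)
  moreover have "?T (\<lambda>k. z * \<xi> k) = (\<lambda>k. z * ?T \<xi> k)" for z \<xi>
    by (simp add: fun_eq_iff mult.left_commute infsum_cmult_right')
  ultimately show ?thesis
    unfolding bounded_op_def using TH by auto
qed

lemma cmod_nct_cocycle: "cmod (nct_cocycle \<Theta> k q) = 1"
  by (simp add: nct_cocycle_def norm_exp_eq_Re)

lemma bounded_op_L_rep:
  assumes "(\<lambda>p. cmod (a p)) summable_on UNIV"
  shows "bounded_op (L_rep \<Theta> a)"
proof (rule bounded_op_cong)
  show "bounded_op (\<lambda>\<xi> k. \<Sum>\<^sub>\<infinity>p. a p * nct_cocycle \<Theta> p (k - p) * \<xi> (k - p))"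
    by (rule bounded_op_twisted_convolution[OF assms]) (simp add: cmod_nct_cocycle)
qed (simp add: L_rep_def nct_mult_def mult.commute mult.left_commute)

lemma bounded_op_R_rep:
  fixes a :: "'n::finite nct"
  assumes "(\<lambda>p. cmod (a p)) summable_on UNIV"
  shows "bounded_op (R_rep \<Theta> a)"
proof (rule bounded_op_cong)
  show "bounded_op (\<lambda>\<xi> k. \<Sum>\<^sub>\<infinity>p. a p * nct_cocycle \<Theta> (k - p) p * \<xi> (k - p))"
    by (rule bounded_op_twisted_convolution[OF assms]) (simp add: cmod_nct_cocycle)
  show "(\<lambda>k. \<Sum>\<^sub>\<infinity>p. a p * nct_cocycle \<Theta> (k - p) p * \<xi> (k - p)) = R_rep \<Theta> a \<xi>" for \<xi>
  proof
    fix k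
    \<comment> \<open>The product series is indexed by its left factor \<open>\<xi>\<close>; the
      involution p -> k - p reindexes it by the summable factor \<open>a\<close>.\<close>
    have "bij_betw (\<lambda>p. k - p) UNIV (UNIV :: (int ^ 'n) set)"
      by (rule bij_betwI[where g = "\<lambda>p. k - p"]) auto
    from infsum_reindex_bij_betw[OF this, of "\<lambda>p. \<xi> p * a (k - p) * nct_cocycle \<Theta> p (k - p)"]
    show "(\<Sum>\<^sub>\<infinity>p. a p * nct_cocycle \<Theta> (k - p) p * \<xi> (k - p)) = R_rep \<Theta> a \<xi> k"
      by (simp add: R_rep_def nct_mult_def mult.commute mult.left_commute)
  qed
qed

section \<open>Summability of rapidly decreasing families on the lattice\<close>

lemma summable_on_int_inverse_square: "(\<lambda>j::int. inverse ((1 + \<bar>real_of_int j\<bar>)\<^sup>2)) summable_on UNIV"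
proof -
  have *: "(\<lambda>n::nat. inverse ((1 + real n)\<^sup>2)) summable_on UNIV"
  proof (rule summable_nonneg_imp_summable_on)
    have "summable (\<lambda>n. inverse (real (Suc n) ^ 2))"
      by (subst summable_Suc_iff) (rule inverse_power_summable, simp)
    then show "summable (\<lambda>n::nat. inverse ((1 + real n)\<^sup>2))" by simp
  qed auto
  have UN: "(UNIV :: int set) = range int \<union> range (\<lambda>n. - int n)"
    by (auto simp: image_iff) (metis int_cases2)
  show ?thesis
    unfolding UN
  proof (rule summable_on_union)
    show "(\<lambda>j::int. inverse ((1 + \<bar>real_of_int j\<bar>)\<^sup>2)) summable_on range int"
      by (subst summable_on_reindex) (auto simp: o_def * inj_def)
    show "(\<lambda>j::int. inverse ((1 + \<bar>real_of_int j\<bar>)\<^sup>2)) summable_on range (\<lambda>n. - int n)"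
      by (subst summable_on_reindex) (auto simp: o_def * inj_def)
  qed
qed

text \<open>Each |k_i| is at most the norm of k, so (1 + |k|)^(2n) dominates the product of the (1 +
  |k_i|)^2. The exponent thus allots a square to each coordinate, and a product of convergent
  one-dimensional series is a majorant.\<close>

lemma summable_on_lattice_inverse_power:
  "(\<lambda>k::int ^ 'n::finite. inverse ((1 + norm (rvec k)) ^ (2 * CARD('n)))) summable_on UNIV"
proof -
  let ?g = "\<lambda>j::int. inverse ((1 + \<bar>real_of_int j\<bar>)\<^sup>2)"
  have "Infinite_Set_Sum.abs_summable_on (\<lambda>k. \<Prod>i\<in>(UNIV::'n set). ?g (k i)) (PiE UNIV (\<lambda>_. UNIV))"
    by (rule abs_summable_on_prod_PiE)
      (auto simp: summable_on_int_inverse_square simp flip: abs_summable_equivalent)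
  then have "(\<lambda>k. \<Prod>i\<in>(UNIV::'n set). ?g (k i)) summable_on UNIV"
    using abs_summable_summable abs_summable_equivalent by fastforce
  moreover have "bij_betw (\<lambda>k::int ^ 'n. ($) k) UNIV UNIV"
    by (rule bij_betwI[where g = vec_lambda]) auto
  ultimately have "(\<lambda>k::int ^ 'n. \<Prod>i\<in>UNIV. ?g (k $ i)) summable_on UNIV"
    using summable_on_reindex_bij_betw[of "\<lambda>k::int ^ 'n. ($) k" UNIV UNIV "\<lambda>k. \<Prod>i\<in>UNIV. ?g (k i)"] by simp
  then show ?thesis
  proof (rule summable_on_comparison_test)
    fix k :: "int ^ 'n"
    have "(\<Prod>i\<in>(UNIV::'n set). (1 + \<bar>real_of_int (k $ i)\<bar>)\<^sup>2) \<le> (\<Prod>i\<in>(UNIV::'n set). (1 + norm (rvec k))\<^sup>2)"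
    proof (intro prod_mono conjI power_mono add_left_mono)
      show "\<bar>real_of_int (k $ i)\<bar> \<le> norm (rvec k)" for i
        using component_le_norm_cart[of "rvec k" i] by simp
    qed auto
    then have "(\<Prod>i\<in>UNIV. (1 + \<bar>real_of_int (k $ i)\<bar>)\<^sup>2) \<le> (1 + norm (rvec k)) ^ (2 * CARD('n))"
      by (simp add: power_mult)
    moreover have "0 < (\<Prod>i\<in>UNIV. (1 + \<bar>real_of_int (k $ i)\<bar>)\<^sup>2)"
      by (intro prod_pos) auto
    ultimately show "inverse ((1 + norm (rvec k)) ^ (2 * CARD('n))) \<le> (\<Prod>i\<in>UNIV. ?g (k $ i))"
      unfolding prod_inversef[unfolded comp_def] by (rule le_imp_inverse_le)
  qed auto
qed

lemma nct_smooth_summable: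
  fixes a :: "'n::finite nct"
  assumes "a \<in> nct_smooth"
  shows "(\<lambda>k. cmod (a k)) summable_on UNIV"
proof -
  obtain C where C: "\<And>k. (1 + norm (rvec k)) ^ (2 * CARD('n)) * cmod (nct_coeff a k) \<le> C"
    using assms by (auto simp: nct_smooth_def rapidly_decreasing_def)
  let ?c = "(2 * pi) powr (real CARD('n) / 2)"
  have c: "0 < ?c" by simp
  have "(\<lambda>k::int ^ 'n. C / ?c * inverse ((1 + norm (rvec k)) ^ (2 * CARD('n)))) summable_on UNIV"
    by (intro summable_on_cmult_right summable_on_lattice_inverse_power)
  then show ?thesis
  proof (rule summable_on_comparison_test)
    fix k :: "int ^ 'n"
    have "0 < (1 + norm (rvec k)) ^ (2 * CARD('n))"
      by (intro zero_less_power add_pos_nonneg) auto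
    then show "cmod (a k) \<le> C / ?c * inverse ((1 + norm (rvec k)) ^ (2 * CARD('n)))"
      using C[of k] c by (simp add: nct_coeff_def norm_mult field_simps)
  qed auto
qed


section \<open>Linear change of variables\<close>

lemma prod_Basis_vec: "(\<Prod>b\<in>(Basis :: (real ^ 'n) set). f b) = (\<Prod>i\<in>(UNIV::'n::finite set). f (axis i 1))"
proof -
  have B: "(Basis :: (real ^ 'n) set) = range (\<lambda>i. axis i 1)"
    by (auto simp: Basis_vec_def)
  have "inj (\<lambda>i::'n. axis i (1::real))"
    by (auto simp: inj_def axis_eq_axis)
  then show ?thesis
    unfolding B by (subst prod.reindex) auto
qed

lemma borel_measurable_vec:
  fixes f :: "'a \<Rightarrow> real ^ 'n::finite"
  assumes "\<And>i. (\<lambda>x. f x $ i) \<in> borel_measurable M"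
  shows "f \<in> borel_measurable M"
  unfolding borel_measurable_euclidean_space[of f] using assms
  by (auto simp: Basis_vec_def inner_axis)

lemma borel_measurable_vec_nth [measurable]: "(\<lambda>x :: real ^ 'n::finite. x $ i) \<in> borel_measurable borel"
  by (intro borel_measurable_continuous_onI continuous_intros)

lemma borel_measurable_matrix_vector_mult [measurable]:
  "(\<lambda>x. A *v x) \<in> borel_measurable (borel :: (real ^ 'n::finite) measure)"
  by (intro borel_measurable_continuous_onI) (simp add: linear_continuous_on matrix_vector_mul_bounded_linear)

text \<open>Lebesgue measure is determined by its values on boxes, so only products of side lengths
  have to be compared. The product form gives Fubini in a single coordinate, which the shears
  require.\<close>

lemma lborel_eq_vec_lambda:
  "(lborel :: (real ^ 'n::finite) measure) = distr (\<Pi>\<^sub>M i\<in>UNIV. lborel) borel vec_lambda"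
proof (rule lborel_eqI)
  interpret product_sigma_finite "\<lambda>_::'n. lborel :: real measure" ..
  have meas: "vec_lambda \<in> borel_measurable (\<Pi>\<^sub>M i\<in>(UNIV::'n set). (lborel :: real measure))"
    by (rule borel_measurable_vec) simp
  fix l u :: "real ^ 'n"
  assume lu: "\<And>b. b \<in> Basis \<Longrightarrow> l \<bullet> b \<le> u \<bullet> b"
  have lu': "l $ i \<le> u $ i" for i
    using lu[of "axis i 1"] by (simp add: inner_axis)
  have "vec_lambda -` box l u \<inter> space (\<Pi>\<^sub>M i\<in>UNIV. lborel) = (\<Pi>\<^sub>E i\<in>UNIV. {l $ i <..< u $ i})"
    by (auto simp: space_PiM mem_box_cart PiE_iff)
  then have "emeasure (distr (\<Pi>\<^sub>M i\<in>UNIV. lborel) borel vec_lambda) (box l u) =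
      emeasure (\<Pi>\<^sub>M i\<in>UNIV. lborel) (\<Pi>\<^sub>E i\<in>(UNIV::'n set). {l $ i <..< u $ i})"
    using meas by (simp add: emeasure_distr)
  also have "\<dots> = (\<Prod>i\<in>UNIV. ennreal (u $ i - l $ i))"
    using lu' by (subst emeasure_PiM) auto
  also have "\<dots> = (\<Prod>b\<in>Basis. (u - l) \<bullet> b)"
    using lu' by (simp add: prod_Basis_vec inner_axis prod_ennreal)
  finally show "emeasure (distr (\<Pi>\<^sub>M i\<in>UNIV. lborel) borel vec_lambda) (box l u) = (\<Prod>b\<in>Basis. (u - l) \<bullet> b)" .
qed simp

lemma nn_integral_lborel_vec:
  assumes "f \<in> borel_measurable borel"
  shows "(\<integral>\<^sup>+x. f x \<partial>(lborel :: (real ^ 'n::finite) measure)) = (\<integral>\<^sup>+x. f (vec_lambda x) \<partial>(\<Pi>\<^sub>M i\<in>UNIV. lborel))"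
proof -
  have "vec_lambda \<in> borel_measurable (\<Pi>\<^sub>M i\<in>(UNIV::'n set). (lborel :: real measure))"
    by (rule borel_measurable_vec) simp
  then show ?thesis
    using assms by (subst lborel_eq_vec_lambda) (rule nn_integral_distr, auto)
qed

lemma nn_integral_lborel_permute:
  fixes f :: "real ^ 'n::finite \<Rightarrow> ennreal"
  assumes p: "p permutes UNIV" and f: "f \<in> borel_measurable borel"
  shows "(\<integral>\<^sup>+x. f (\<chi> i. x $ p i) \<partial>lborel) = (\<integral>\<^sup>+x. f x \<partial>lborel)"
proof -
  have meas: "(\<lambda>x :: real ^ 'n. \<chi> i. x $ p i) \<in> borel_measurable borel"
    by (rule borel_measurable_vec) simp
  have "(lborel :: (real ^ 'n) measure) = distr lborel borel (\<lambda>x. \<chi> i. x $ p i)"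
  proof (rule lborel_eqI)
    fix l u :: "real ^ 'n"
    assume lu: "\<And>b. b \<in> Basis \<Longrightarrow> l \<bullet> b \<le> u \<bullet> b"
    have lu': "l $ i \<le> u $ i" for i
      using lu[of "axis i 1"] by (simp add: inner_axis)
    let ?q = "inv p"
    have pq: "p (?q i) = i" "?q (p i) = i" for i
      using p by (auto simp: permutes_inverses)
    have "(\<lambda>x. \<chi> i. x $ p i) -` box l u = box (\<chi> i. l $ ?q i) (\<chi> i. u $ ?q i)"
      by (auto simp: mem_box_cart) (metis pq)+
    then have "emeasure (distr lborel borel (\<lambda>x. \<chi> i. x $ p i)) (box l u) =
        emeasure lborel (box (\<chi> i. l $ ?q i) (\<chi> i. u $ ?q i))"
      using meas by (simp add: emeasure_distr)
    also have "\<dots> = (\<Prod>i\<in>UNIV. u $ ?q i - l $ ?q i)"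
    proof (subst emeasure_lborel_box)
      show "(\<chi> i. l $ ?q i) \<bullet> b \<le> (\<chi> i. u $ ?q i) \<bullet> b" if "b \<in> Basis" for b :: "real ^ 'n"
        using that lu' by (auto simp: Basis_vec_def inner_axis)
    qed (simp add: prod_Basis_vec inner_axis)
    also have "(\<Prod>i\<in>UNIV. u $ ?q i - l $ ?q i) = (\<Prod>i\<in>UNIV. u $ i - l $ i)"
      using prod.permute[OF permutes_inv[OF p], of "\<lambda>i. u $ i - l $ i"] by (simp add: comp_def)
    finally show "emeasure (distr lborel borel (\<lambda>x. \<chi> i. x $ p i)) (box l u) = (\<Prod>b\<in>Basis. (u - l) \<bullet> b)"
      by (simp add: prod_Basis_vec inner_axis)
  qed simp
  then show ?thesis
    using nn_integral_distr[of "\<lambda>x. \<chi> i. x $ p i" lborel borel f] meas f by simp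
qed

text \<open>Fubini isolates coordinate \<open>m\<close>. With the others fixed, coordinate
  \<open>n\<close> among them, the shear is a translation in one variable, and one-dimensional
  Lebesgue measure is invariant under it.\<close>

lemma nn_integral_lborel_shear:
  fixes f :: "real ^ 'n::finite \<Rightarrow> ennreal"
  assumes mn: "m \<noteq> n" and f [measurable]: "f \<in> borel_measurable borel"
  shows "(\<integral>\<^sup>+x. f (\<chi> i. if i = m then x $ m + x $ n else x $ i) \<partial>lborel) = (\<integral>\<^sup>+x. f x \<partial>lborel)"
proof -
  interpret product_sigma_finite "\<lambda>_::'n. lborel :: real measure" ..
  let ?P = "\<lambda>I. \<Pi>\<^sub>M i\<in>(I::'n set). (lborel :: real measure)"
  let ?s = "\<lambda>x :: real ^ 'n. \<chi> i. if i = m then x $ m + x $ n else x $ i"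
  have s [measurable]: "?s \<in> borel_measurable borel"
    by (rule borel_measurable_vec) simp
  have v [measurable]: "vec_lambda \<in> borel_measurable (?P UNIV)"
    by (rule borel_measurable_vec) simp
  have ins: "(UNIV :: 'n set) = insert m (UNIV - {m})" by auto
  have fubini: "(\<integral>\<^sup>+x. h (vec_lambda x) \<partial>?P UNIV) =
      (\<integral>\<^sup>+x. (\<integral>\<^sup>+y. h (vec_lambda (x(m := y))) \<partial>lborel) \<partial>?P (UNIV - {m}))"
    if h [measurable]: "h \<in> borel_measurable borel" for h :: "real ^ 'n \<Rightarrow> ennreal"
  proof -
    have "(\<lambda>x. h (vec_lambda x)) \<in> borel_measurable (?P (insert m (UNIV - {m})))"
      unfolding ins[symmetric] by measurable
    from product_nn_integral_insert[OF _ _ this] show ?thesis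
      unfolding ins[symmetric] by simp
  qed
  have inner: "(\<integral>\<^sup>+y. f (?s (vec_lambda (x(m := y)))) \<partial>lborel) = (\<integral>\<^sup>+y. f (vec_lambda (x(m := y))) \<partial>lborel)" for x
  proof -
    have [measurable]: "(\<lambda>y. vec_lambda (x(m := y)) :: real ^ 'n) \<in> borel_measurable borel"
      by (rule borel_measurable_vec) simp
    have "?s (vec_lambda (x(m := y))) = vec_lambda (x(m := x n + 1 * y))" for y
      using mn by (auto simp: vec_eq_iff)
    then show ?thesis
      using nn_integral_real_affine[of "\<lambda>y. f (vec_lambda (x(m := y)))" 1 "x n"] by simp
  qed
  have "(\<integral>\<^sup>+x. f (?s x) \<partial>lborel) = (\<integral>\<^sup>+x. f (?s (vec_lambda x)) \<partial>?P UNIV)"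
    by (rule nn_integral_lborel_vec) measurable
  also have "\<dots> = (\<integral>\<^sup>+x. f (vec_lambda x) \<partial>?P UNIV)"
    using fubini[of "\<lambda>x. f (?s x)"] fubini[of f] inner by simp
  also have "\<dots> = (\<integral>\<^sup>+x. f x \<partial>lborel)"
    by (rule nn_integral_lborel_vec[symmetric]) measurable
  finally show ?thesis .
qed

lemma nn_integral_lborel_diagonal:
  fixes A :: "real ^ 'n ^ 'n::finite" and f :: "real ^ 'n \<Rightarrow> ennreal"
  assumes diag: "\<And>i j. i \<noteq> j \<Longrightarrow> A $ i $ j = 0" and det: "det A \<noteq> 0"
    and f [measurable]: "f \<in> borel_measurable borel"
  shows "ennreal \<bar>det A\<bar> * (\<integral>\<^sup>+x. f (A *v x) \<partial>lborel) = (\<integral>\<^sup>+x. f x \<partial>lborel)"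
proof -
  define c where "c b = A $ axis_index b $ axis_index b" for b :: "real ^ 'n"
  have dA: "det A = (\<Prod>i\<in>UNIV. A $ i $ i)"
    by (rule det_diagonal) (use diag in auto)
  then have nz: "c b \<noteq> 0" for b
    using det by (auto simp: c_def)
  \<comment> \<open>The left side has the shape of an affine map that scales along the basis
    vectors, here with offset 0 and the diagonal entries as scaling factors.\<close>
  have T: "0 + (\<Sum>j\<in>Basis. (c j * (x \<bullet> j)) *\<^sub>R j) = A *v x" for x
  proof -
    have "((\<Sum>j\<in>Basis. (c j * (x \<bullet> j)) *\<^sub>R j) :: real ^ 'n) $ i = (A *v x) $ i" for i
    proof -
      have "((\<Sum>j\<in>Basis. (c j * (x \<bullet> j)) *\<^sub>R j) :: real ^ 'n) $ i = c (axis i 1) * (x \<bullet> axis i 1)"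
        by (simp add: cart_eq_inner_axis[of _ i])
      also have "\<dots> = A $ i $ i * x $ i"
        by (simp add: c_def inner_axis)
      also have "\<dots> = (A *v x) $ i"
        using diag by (simp add: matrix_vector_mult_def sum.remove[of UNIV i])
      finally show ?thesis .
    qed
    then show ?thesis by (simp add: vec_eq_iff)
  qed
  have "(\<Prod>j\<in>Basis. \<bar>c j\<bar>) = \<bar>det A\<bar>"
    by (simp add: dA prod_Basis_vec c_def abs_prod)
  then have "(lborel :: (real ^ 'n) measure) = density (distr lborel borel ((*v) A)) (\<lambda>_. ennreal \<bar>det A\<bar>)"
    using lborel_affine_euclidean[of c 0, OF nz] unfolding T by simp
  then have "(\<integral>\<^sup>+x. f x \<partial>lborel) = (\<integral>\<^sup>+x. f x \<partial>density (distr lborel borel ((*v) A)) (\<lambda>_. ennreal \<bar>det A\<bar>))"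
    by simp
  also have "\<dots> = ennreal \<bar>det A\<bar> * (\<integral>\<^sup>+x. f (A *v x) \<partial>lborel)"
    by (simp add: nn_integral_density nn_integral_distr nn_integral_cmult)
  finally show ?thesis by simp
qed

text \<open>The library has the linear change of variables only for well-ordered index types.\<close>

lemma nn_integral_lborel_matrix:
  fixes A :: "real ^ 'n ^ 'n::finite"
  assumes "det A \<noteq> 0" and "f \<in> borel_measurable borel"
  shows "ennreal \<bar>det A\<bar> * (\<integral>\<^sup>+x. f (A *v x) \<partial>lborel) = (\<integral>\<^sup>+x. f x \<partial>lborel)"
proof -
  \<comment> \<open>The induction runs over products of elementary matrices. With \<open>f\<close>
    quantified inside, the hypothesis for \<open>B\<close> applies to x -> f(A x); with the
    determinant as a premise, the zero-row case is vacuous.\<close>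
  have "det A \<noteq> 0 \<longrightarrow> (\<forall>f \<in> borel_measurable borel.
      ennreal \<bar>det A\<bar> * (\<integral>\<^sup>+x. f (A *v x) \<partial>lborel) = (\<integral>\<^sup>+x. f x \<partial>lborel))"
  proof (induction A rule: induct_matrix_elementary_alt)
    case (1 A B)
    show ?case
    proof (intro impI ballI)
      assume "det (A ** B) \<noteq> 0"
      then have d: "det A \<noteq> 0" "det B \<noteq> 0" by (auto simp: det_mul)
      fix f :: "real ^ 'n \<Rightarrow> ennreal" assume f [measurable]: "f \<in> borel_measurable borel"
      have "ennreal \<bar>det B\<bar> * (\<integral>\<^sup>+x. f (A *v (B *v x)) \<partial>lborel) = (\<integral>\<^sup>+x. f (A *v x) \<partial>lborel)"
        using 1(2) d by (auto dest!: bspec[where x = "\<lambda>x. f (A *v x)"])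
      moreover have "ennreal \<bar>det A\<bar> * (\<integral>\<^sup>+x. f (A *v x) \<partial>lborel) = (\<integral>\<^sup>+x. f x \<partial>lborel)"
        using 1(1) d f by auto
      ultimately show "ennreal \<bar>det (A ** B)\<bar> * (\<integral>\<^sup>+x. f ((A ** B) *v x) \<partial>lborel) = (\<integral>\<^sup>+x. f x \<partial>lborel)"
        by (simp add: det_mul abs_mult ennreal_mult mult.assoc matrix_vector_mul_assoc)
    qed
  next
    case (2 A i)
    then show ?case by (simp add: det_zero_row(1))
  next
    case (3 A)
    then show ?case using nn_integral_lborel_diagonal by blast
  next
    case (4 m n)
    let ?p = "Transposition.transpose m n" and ?A = "(\<chi> i j. mat 1 $ i $ Transposition.transpose m n j) :: real ^ 'n ^ 'n"
    have p: "?p permutes UNIV" by (simp add: permutes_swap_id)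
    have "\<bar>det ?A\<bar> = 1"
      using det_permute_columns[OF p, of "mat 1 :: real ^ 'n ^ 'n"] 4 by (simp add: sign_swap_id)
    moreover have "?A *v x = (\<chi> i. x $ ?p i)" for x
    proof -
      have "(\<Sum>j\<in>UNIV. (if i = ?p j then 1 else 0) * x $ j) = x $ ?p i" for i
      proof -
        have "(i = ?p j) = (j = ?p i)" for j by (metis transpose_involutory)
        then show ?thesis by (simp add: if_distrib[of "\<lambda>c. c * _"] cong: if_cong)
      qed
      then show ?thesis by (simp add: matrix_vector_mult_def mat_def vec_eq_iff)
    qed
    ultimately show ?case
      using nn_integral_lborel_permute[OF p] by auto
  next
    case (5 m n)
    let ?A = "(\<chi> i j. of_bool (i = m \<and> j = n \<or> i = j)) :: real ^ 'n ^ 'n"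
    have "?A = (\<chi> k. if k = m then row m (mat 1) + 1 *s row n (mat 1) else row k (mat 1))"
      using 5 by (auto simp: vec_eq_iff row_def mat_def)
    then have "det ?A = 1"
      using det_row_operation[OF 5, of "mat 1 :: real ^ 'n ^ 'n" 1] by simp
    moreover have "?A *v x = (\<chi> i. if i = m then x $ m + x $ n else x $ i)" for x
    proof -
      have *: "of_bool (i = m \<and> j = n \<or> i = j) * x $ j =
          (if j = i then x $ j else 0) + (if j = n then if i = m then x $ j else 0 else 0)" for i j
        using 5 by auto
      have "(\<Sum>j\<in>UNIV. of_bool (i = m \<and> j = n \<or> i = j) * x $ j) = (if i = m then x $ m + x $ n else x $ i)" for i
        unfolding * by (simp add: sum.distrib)
      then show ?thesis
        by (simp only: matrix_vector_mult_def vec_lambda_beta)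
    qed
    ultimately show ?case
      using nn_integral_lborel_shear[OF 5] by auto
  qed
  with assms show ?thesis by blast
qed

section \<open>Standard Gaussian integrals\<close>

lemma nn_integral_gaussian: "(\<integral>\<^sup>+x. ennreal (exp (- x\<^sup>2)) \<partial>lborel) = ennreal (sqrt pi)"
proof -
  have "has_bochner_integral lborel (\<lambda>x::real. exp (- x\<^sup>2)) (2 *\<^sub>R (sqrt pi / 2))"
    by (rule has_bochner_integral_even_function[OF gaussian_moment_0]) simp
  then show ?thesis
    by (simp add: has_bochner_integral_iff nn_integral_eq_integral)
qed

lemma nn_integral_gaussian_vec:
  "(\<integral>\<^sup>+x. ennreal (exp (- (norm x)\<^sup>2)) \<partial>(lborel :: (real ^ 'n::finite) measure)) =
    ennreal (pi powr (real CARD('n) / 2))"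
proof -
  have "exp (- (norm x)\<^sup>2) = (\<Prod>b\<in>Basis. exp (- (x \<bullet> b)\<^sup>2))" for x :: "real ^ 'n"
    by (simp add: exp_sum[symmetric] sum_negf norm_eq_sqrt_inner euclidean_inner[of x x] power2_eq_square
        sum_nonneg)
  then have "(\<integral>\<^sup>+x. ennreal (exp (- (norm x)\<^sup>2)) \<partial>(lborel :: (real ^ 'n) measure)) =
      (\<integral>\<^sup>+x. (\<Prod>b\<in>Basis. ennreal (exp (- (x \<bullet> b)\<^sup>2))) \<partial>(lborel :: (real ^ 'n) measure))"
    by (simp add: prod_ennreal)
  also have "\<dots> = (\<Prod>b\<in>(Basis :: (real ^ 'n) set). ennreal (sqrt pi))"
    by (subst nn_integral_lborel_prod) (auto simp: nn_integral_gaussian)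
  also have "\<dots> = ennreal (sqrt pi ^ CARD('n))"
    by (simp add: ennreal_power)
  also have "sqrt pi ^ CARD('n) = pi powr (real CARD('n) / 2)"
    by (simp add: powr_half_sqrt[symmetric] powr_powr flip: powr_realpow)
  finally show ?thesis .
qed


section \<open>Gaussian integrals and lattice sums\<close>

lemma inner_transpose:
  fixes A :: "real ^ 'n ^ 'm"
  shows "x \<bullet> (transpose A *v y) = (A *v x) \<bullet> y"
  by (metis dot_lmul_matrix inner_commute transpose_matrix_vector)

text \<open>Gram-Schmidt by maximality. Sets orthonormal for the form of \<open>gi\<close> are
  independent, so one of largest size exists; a vector outside its span, minus its projection and
  normalized, would enlarge it. The columns of \<open>P\<close> are the members of this set.\<close>

lemma metric_orthonormal_frame:
  fixes gi :: "real ^ 'n ^ 'n::finite"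
  assumes "constant_metric gi"
  obtains P :: "real ^ 'n ^ 'n" where "transpose P ** gi ** P = mat 1"
proof -
  define B where "B x y = x \<bullet> (gi *v y)" for x y
  have pos: "B x x > 0" if "x \<noteq> 0" for x
    using assms that by (simp add: constant_metric_def B_def)
  have sym: "B x y = B y x" for x y
  proof -
    have "x v* gi = gi *v x"
      using assms by (metis constant_metric_def transpose_matrix_vector)
    then have "B x y = (gi *v x) \<bullet> y"
      by (simp add: B_def flip: dot_lmul_matrix)
    then show ?thesis
      by (simp add: B_def inner_commute)
  qed
  have lin: "linear (B x)" for x
    unfolding B_def by (intro linearI) (simp_all add: matrix_vector_right_distrib inner_add_right
        matrix_vector_mult_scaleR)
  define good where "good S \<longleftrightarrow> finite S \<and> (\<forall>x\<in>S. B x x = 1) \<and> (\<forall>x\<in>S. \<forall>y\<in>S. x \<noteq> y \<longrightarrow> B x y = 0)"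
    for S :: "(real ^ 'n) set"
  have Bsum: "B x (\<Sum>v\<in>S. u v *\<^sub>R v) = u x" if "good S" "x \<in> S" for x u S
  proof -
    have "B x (\<Sum>v\<in>S. u v *\<^sub>R v) = (\<Sum>v\<in>S. u v * B x v)"
      by (simp add: linear_sum[OF lin] linear_scale[OF lin])
    also have "\<dots> = (\<Sum>v\<in>S. if v = x then u x else 0)"
      using that by (intro sum.cong) (auto simp: good_def)
    finally show ?thesis using that by (simp add: good_def)
  qed
  have indep: "independent S" if S: "good S" for S
  proof
    assume "dependent S"
    then obtain u where "\<exists>v\<in>S. u v \<noteq> 0" "(\<Sum>v\<in>S. u v *\<^sub>R v) = 0"
      using S by (auto simp: good_def dependent_finite)
    moreover have "B v 0 = 0" for v by (rule linear_0[OF lin])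
    ultimately show False using Bsum[OF S] by metis
  qed
  have good0: "good {}" by (simp add: good_def)
  have bound: "\<forall>S. good S \<longrightarrow> card S < Suc CARD('n)"
    using indep independent_bound by (fastforce simp: less_Suc_eq_le)
  obtain S where S: "good S" and max: "\<And>T. good T \<Longrightarrow> card T \<le> card S"
    using ex_has_greatest_nat[where P = good and f = card, OF good0 bound] by auto
  have "span S = UNIV"
  proof (rule ccontr)
    assume "span S \<noteq> UNIV"
    then obtain v where v: "v \<notin> span S" by auto
    define w where "w = v - (\<Sum>x\<in>S. B x v *\<^sub>R x)"
    have "(\<Sum>x\<in>S. B x v *\<^sub>R x) \<in> span S"
      by (intro span_sum span_scale span_base)
    then have w0: "w \<noteq> 0"
      using v by (auto simp: w_def)
    have orth: "B x w = 0" if "x \<in> S" for x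
      using Bsum[OF S that] by (simp add: w_def linear_diff[OF lin])
    define z where "z = (1 / sqrt (B w w)) *\<^sub>R w"
    have "B z z = (1 / sqrt (B w w)) * B w z"
      using sym[of w z] by (simp add: z_def linear_scale[OF lin])
    also have "\<dots> = 1"
      using pos[OF w0] by (simp add: z_def linear_scale[OF lin])
    finally have zz: "B z z = 1" .
    have zo: "B x z = 0" if "x \<in> S" for x
      using orth[OF that] by (simp add: z_def linear_scale[OF lin])
    \<comment> \<open>A member of \<open>S\<close> is orthogonal to \<open>z\<close> by
      \<open>zo\<close>; membership of \<open>z\<close> itself would contradict
      \<open>zz\<close>.\<close>
    have "z \<notin> S" using zz zo by force
    moreover have "good (insert z S)"
      using S zz zo sym by (auto simp: good_def)
    ultimately show False
      using max[of "insert z S"] S by (simp add: good_def)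
  qed
  then have "card S = CARD('n)"
    using dim_eq_card_independent[OF indep[OF S]] dim_span[of S] by simp
  moreover have "finite S" using S by (simp add: good_def)
  ultimately obtain b where b: "bij_betw b (UNIV :: 'n set) S"
    using finite_same_card_bij[of "UNIV :: 'n set" S] by auto
  define P where "P = (\<chi> i j. b j $ i)"
  have col: "P *v axis j 1 = b j" for j
    by (simp add: P_def vec_eq_iff matrix_vector_mult_def axis_def if_distrib cong: if_cong)
  have entry: "M $ i $ j = axis i 1 \<bullet> (M *v axis j 1)" for M :: "real ^ 'n ^ 'n" and i j
    by (simp add: matrix_vector_mult_basis column_def inner_axis')
  have "(transpose P ** gi ** P) $ i $ j = mat 1 $ i $ j" for i j
  proof -
    have "(transpose P ** gi ** P) $ i $ j = axis i 1 \<bullet> (transpose P *v (gi *v (P *v axis j 1)))"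
      by (simp only: entry flip: matrix_vector_mul_assoc)
    also have "\<dots> = (P *v axis i 1) \<bullet> (gi *v (P *v axis j 1))"
      by (rule inner_transpose)
    also have "\<dots> = B (b i) (b j)"
      by (simp add: col B_def)
    also have "\<dots> = mat 1 $ i $ j"
      using S b by (auto simp: good_def mat_def bij_betw_def inj_eq)
    finally show ?thesis .
  qed
  then show thesis
    using that[of P] by (simp add: vec_eq_iff)
qed

text \<open>Determinants in P^T gi P = 1 give (det P)^2 det gi = 1, which identifies sqrt g with the
  Jacobian of the frame. This is how sqrt g enters the Gaussian integral.\<close>

lemma metric_frame:
  fixes gi :: "real ^ 'n ^ 'n::finite"
  assumes "constant_metric gi"
  obtains P :: "real ^ 'n ^ 'n" where "det P \<noteq> 0" "sqrt_g gi = \<bar>det P\<bar>" "\<And>x. (P *v x) \<bullet> (gi *v (P *v x)) = (norm x)\<^sup>2"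
proof -
  obtain P :: "real ^ 'n ^ 'n" where P: "transpose P ** gi ** P = mat 1"
    using metric_orthonormal_frame[OF assms] by blast
  have "det (transpose P ** gi ** P) = 1" by (simp add: P)
  then have d: "(det P)\<^sup>2 * det gi = 1"
    by (simp add: det_mul power2_eq_square mult.commute mult.left_commute)
  have gi0: "det gi \<noteq> 0" and P0: "det P \<noteq> 0" using d by auto
  \<comment> \<open>\<open>matrix_inv\<close> is a Hilbert choice, so its defining property is
    available once some two-sided inverse exists.\<close>
  have "\<exists>A'. gi ** A' = mat 1 \<and> A' ** gi = mat 1"
    using gi0 invertible_det_nz invertible_def by blast
  then have "gi ** matrix_inv gi = mat 1"
    unfolding matrix_inv_def by (rule someI2_ex) simp
  then have "det gi * det (matrix_inv gi) = 1"
    by (metis det_I det_mul)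
  then have "det (matrix_inv gi) = (det P)\<^sup>2"
    using d gi0 by (metis mult.commute mult_cancel_left)
  then have "sqrt_g gi = \<bar>det P\<bar>" by (simp add: sqrt_g_def)
  moreover have "(P *v x) \<bullet> (gi *v (P *v x)) = (norm x)\<^sup>2" for x
  proof -
    have "(P *v x) \<bullet> (gi *v (P *v x)) = x \<bullet> ((transpose P ** gi ** P) *v x)"
      by (simp only: inner_transpose flip: matrix_vector_mul_assoc)
    then show ?thesis by (simp add: P power2_norm_eq_inner)
  qed
  ultimately show thesis using that P0 by blast
qed

text \<open>For x = P y the form equals |y|^2, while |x| \<le> K |y| with an operator bound K of
  \<open>P\<close>; hence c = 1/K^2.\<close>

lemma metric_coercive:
  fixes gi :: "real ^ 'n ^ 'n::finite"
  assumes "constant_metric gi"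
  obtains c where "c > 0" "\<And>x. c * (norm x)\<^sup>2 \<le> x \<bullet> (gi *v x)"
proof -
  obtain P :: "real ^ 'n ^ 'n" where P: "det P \<noteq> 0" "\<And>x. (P *v x) \<bullet> (gi *v (P *v x)) = (norm x)\<^sup>2"
    using metric_frame[OF assms] by blast
  obtain K where K: "K > 0" "\<And>x. norm (P *v x) \<le> norm x * K"
    using bounded_linear.pos_bounded[OF matrix_vector_mul_bounded_linear[of P]] by blast
  have "inverse (K\<^sup>2) * (norm x)\<^sup>2 \<le> x \<bullet> (gi *v x)" for x
  proof -
    obtain R where "P ** R = mat 1"
      using P(1) by (auto simp: invertible_def simp flip: invertible_det_nz)
    then have x: "x = P *v (R *v x)"
      by (simp add: matrix_vector_mul_assoc)
    define y where "y = R *v x"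
    with x have x: "x = P *v y" by simp
    have "(norm x)\<^sup>2 \<le> (norm y * K)\<^sup>2"
      unfolding x by (intro power_mono K) auto
    then show ?thesis
      using K(1) by (simp add: x P(2) field_simps power_mult_distrib)
  qed
  then show thesis
    using that[of "inverse (K\<^sup>2)"] K(1) by simp
qed

lemma nn_integral_gaussian_metric:
  fixes gi :: "real ^ 'n ^ 'n::finite"
  assumes "constant_metric gi"
  shows "(\<integral>\<^sup>+x. ennreal (exp (- (x \<bullet> (gi *v x)))) \<partial>lborel) = ennreal (sqrt_g gi * pi powr (real CARD('n) / 2))"
proof -
  obtain P :: "real ^ 'n ^ 'n" where P: "det P \<noteq> 0" "sqrt_g gi = \<bar>det P\<bar>" "\<And>x. (P *v x) \<bullet> (gi *v (P *v x)) = (norm x)\<^sup>2"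
    using metric_frame[OF assms] by blast
  have "(\<integral>\<^sup>+x. ennreal (exp (- (x \<bullet> (gi *v x)))) \<partial>lborel) =
      ennreal \<bar>det P\<bar> * (\<integral>\<^sup>+x. ennreal (exp (- (norm x)\<^sup>2)) \<partial>(lborel :: (real ^ 'n) measure))"
    by (subst nn_integral_lborel_matrix[OF P(1), symmetric]) (simp_all add: P(3))
  then show ?thesis
    by (simp add: nn_integral_gaussian_vec P(2) ennreal_mult)
qed

lemma gaussian_metric_integral:
  fixes gi :: "real ^ 'n ^ 'n::finite"
  assumes "constant_metric gi"
  shows "has_bochner_integral lborel (\<lambda>x. exp (- (x \<bullet> (gi *v x)))) (sqrt_g gi * pi powr (real CARD('n) / 2))"
proof (rule has_bochner_integral_nn_integral)
  obtain P :: "real ^ 'n ^ 'n" where "sqrt_g gi = \<bar>det P\<bar>"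
    \<comment> \<open>In HOL the square root of a negative real is negative, so the sign of
      \<open>sqrt_g gi\<close> is read off from its form as an absolute value.\<close>
    using metric_frame[OF assms] by blast
  then show "0 \<le> sqrt_g gi * pi powr (real CARD('n) / 2)" by simp
qed (simp_all add: nn_integral_gaussian_metric[OF assms])

section \<open>Lattice sums as integrals of step functions\<close>

definition lattice_floor :: "real \<Rightarrow> real ^ 'n \<Rightarrow> int ^ 'n" where
  "lattice_floor s x = (\<chi> i. \<lfloor>x $ i / s\<rfloor>)"

lemma measurable_lattice_floor [measurable]:
  "lattice_floor s \<in> borel \<rightarrow>\<^sub>M count_space (UNIV :: (int ^ 'n::finite) set)"
proof (subst measurable_count_space_eq_countable, safe)
  show "lattice_floor s -` {k} \<inter> space borel \<in> sets borel" for k :: "int ^ 'n"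
  proof -
    have "{x \<in> space borel. \<forall>i\<in>UNIV. \<lfloor>x $ i / s\<rfloor> = k $ i} \<in> sets (borel :: (real ^ 'n) measure)"
      by measurable
    then show ?thesis
      by (simp add: lattice_floor_def vimage_def vec_eq_iff)
  qed
qed auto

text \<open>The fibre over k is the half-open cube of side s with lowest corner s k. It is squeezed
  between the open and the closed box with the same corners, both of volume s^n.\<close>

lemma distr_lattice_floor:
  assumes s: "s > 0"
  shows "distr lborel (count_space UNIV) (lattice_floor s) =
    density (count_space (UNIV :: (int ^ 'n::finite) set)) (\<lambda>_. ennreal (s ^ CARD('n)))"
proof (rule measure_eqI_countable[where A = UNIV])
  fix k :: "int ^ 'n"
  let ?S = "lattice_floor s -` {k} \<inter> space lborel"
  define l u where "l = s *\<^sub>R rvec k" and "u = s *\<^sub>R (rvec k + 1)"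
  have mem: "x \<in> ?S \<longleftrightarrow> (\<forall>i. l $ i \<le> x $ i \<and> x $ i < u $ i)" for x
    using s by (simp add: lattice_floor_def vec_eq_iff floor_eq_iff l_def u_def pos_le_divide_eq
        pos_divide_less_eq mult.commute)
  have lu: "l \<bullet> b \<le> u \<bullet> b" if "b \<in> Basis" for b
    using that s by (auto simp: Basis_vec_def inner_axis l_def u_def)
  have vol: "(\<Prod>b\<in>Basis. (u - l) \<bullet> b) = s ^ CARD('n)"
    by (simp add: prod_Basis_vec inner_axis l_def u_def algebra_simps)
  have S: "?S \<in> sets lborel"
    using measurable_sets[OF measurable_lattice_floor, of "{k}" s] by simp
  have "box l u \<subseteq> ?S" "?S \<subseteq> cbox l u"
    unfolding subset_iff mem by (auto simp: mem_box_cart intro: less_imp_le)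
  then have "emeasure lborel (box l u) \<le> emeasure lborel ?S" "emeasure lborel ?S \<le> emeasure lborel (cbox l u)"
    using S by (auto intro: emeasure_mono)
  then have "emeasure lborel ?S = ennreal (s ^ CARD('n))"
    using lu vol by simp
  then show "emeasure (distr lborel (count_space UNIV) (lattice_floor s)) {k} =
      emeasure (density (count_space UNIV) (\<lambda>_. ennreal (s ^ CARD('n)))) {k}"
    using measurable_lattice_floor[of s] by (simp add: emeasure_distr emeasure_density)
qed auto

text \<open>Integrating against the image measure turns the integral of a step function into a
  lattice sum. The equality is exact for each fixed s, without a Riemann-sum error.\<close>

lemma
  fixes h :: "int ^ 'n::finite \<Rightarrow> real"
  assumes s: "s > 0" and int: "integrable lborel (\<lambda>x. h (lattice_floor s x))"
  shows summable_on_lattice: "h summable_on UNIV"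
    and integral_lattice_floor: "(\<integral>x. h (lattice_floor s x) \<partial>lborel) = s ^ CARD('n) * infsum h UNIV"
proof -
  have m: "lattice_floor s \<in> lborel \<rightarrow>\<^sub>M count_space (UNIV :: (int ^ 'n) set)"
    by simp
  have "integrable (density (count_space UNIV) (\<lambda>_. ennreal (s ^ CARD('n)))) h"
    using int integrable_distr_eq[OF m, of h] by (simp add: distr_lattice_floor[OF s])
  then have i: "integrable (count_space UNIV) h"
    using s by (subst (asm) integrable_density) auto
  then have a: "Infinite_Set_Sum.abs_summable_on h UNIV"
    by (simp add: abs_summable_on_def)
  then show "h summable_on UNIV"
    by (metis abs_summable_equivalent abs_summable_summable)
  have "(\<integral>x. h (lattice_floor s x) \<partial>lborel) = (\<integral>k. h k \<partial>density (count_space UNIV) (\<lambda>_. ennreal (s ^ CARD('n))))"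
    using integral_distr[OF m, of h] by (simp add: distr_lattice_floor[OF s])
  also have "\<dots> = s ^ CARD('n) * infsum h UNIV"
    using s infsetsum_infsum[OF a] by (subst integral_density) (auto simp: infsetsum_def)
  finally show "(\<integral>x. h (lattice_floor s x) \<partial>lborel) = s ^ CARD('n) * infsum h UNIV" .
qed

lemma lattice_sum_dominated_convergence:
  fixes h :: "real \<Rightarrow> int ^ 'n::finite \<Rightarrow> real"
  assumes H: "H \<in> borel_measurable borel" and w: "integrable lborel w"
    and bound: "eventually (\<lambda>s. \<forall>x. \<bar>h s (lattice_floor s x)\<bar> \<le> w x) (at_right 0)"
    and lim: "\<And>x. ((\<lambda>s. h s (lattice_floor s x)) \<longlongrightarrow> H x) (at_right 0)"
  shows "((\<lambda>s. s ^ CARD('n) * infsum (h s) UNIV) \<longlongrightarrow> (\<integral>x. H x \<partial>lborel)) (at_right 0)"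
proof -
  have meas: "(\<lambda>x. h s (lattice_floor s x)) \<in> borel_measurable lborel" for s
    by measurable
  have "((\<lambda>s. \<integral>x. h s (lattice_floor s x) \<partial>lborel) \<longlongrightarrow> (\<integral>x. H x \<partial>lborel)) (at_right 0)"
    \<comment> \<open>Inverting s moves the limit to infinity, the form in which dominated
      convergence for a continuous parameter is applied.\<close>
    unfolding filterlim_at_right_to_top
  proof (rule integral_dominated_convergence_at_top[OF _ _ w])
    show "AE x in lborel. ((\<lambda>t. h (inverse t) (lattice_floor (inverse t) x)) \<longlongrightarrow> H x) at_top"
      using lim by (simp add: filterlim_at_right_to_top)
    show "\<forall>\<^sub>F t in at_top. AE x in lborel. norm (h (inverse t) (lattice_floor (inverse t) x)) \<le> w x"
      using bound unfolding eventually_at_right_to_top by eventually_elim auto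
  qed (use H meas in simp_all)
  moreover have "eventually (\<lambda>s. (\<integral>x. h s (lattice_floor s x) \<partial>lborel) = s ^ CARD('n) * infsum (h s) UNIV) (at_right 0)"
    using bound eventually_at_right_less[of 0]
  proof eventually_elim
    case (elim s)
    have "integrable lborel (\<lambda>x. h s (lattice_floor s x))"
      by (rule Bochner_Integration.integrable_bound[OF w meas]) (use elim abs_ge_self order_trans in \<open>auto intro!: AE_I2, blast\<close>)
    then show ?case using integral_lattice_floor elim by blast
  qed
  ultimately show ?thesis by (rule Lim_transform_eventually)
qed

text \<open>Rounding moves each coordinate by at most s, so the l1 norm bounds the displacement by s
  n; the lattice shift \<open>v\<close> adds s |v|. Both vanish with s, so a fixed shift is
  invisible in the limit.\<close>

lemma norm_lattice_floor:
  fixes x :: "real ^ 'n::finite"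
  assumes "s > 0"
  shows "norm (s *\<^sub>R rvec (lattice_floor s x - v) - x) \<le> s * (real CARD('n) + norm (rvec v))"
proof -
  have c: "\<bar>(s *\<^sub>R rvec (lattice_floor s x) - x) $ i\<bar> \<le> s" for i
  proof -
    have "x $ i = s * (x $ i / s)" using assms by simp
    then have "(s *\<^sub>R rvec (lattice_floor s x) - x) $ i = s * (of_int \<lfloor>x $ i / s\<rfloor> - x $ i / s)"
      by (simp add: lattice_floor_def right_diff_distrib)
    moreover have "\<bar>of_int \<lfloor>x $ i / s\<rfloor> - x $ i / s\<bar> \<le> 1" by linarith
    ultimately show ?thesis using assms by (simp add: abs_mult)
  qed
  have "norm (s *\<^sub>R rvec (lattice_floor s x) - x) \<le> (\<Sum>i\<in>UNIV. \<bar>(s *\<^sub>R rvec (lattice_floor s x) - x) $ i\<bar>)"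
    by (rule norm_le_l1_cart)
  also have "\<dots> \<le> real CARD('n) * s"
    using sum_bounded_above[of UNIV, OF c] by simp
  finally have 1: "norm (s *\<^sub>R rvec (lattice_floor s x) - x) \<le> s * real CARD('n)"
    by (simp add: mult.commute)
  have "s *\<^sub>R rvec (lattice_floor s x - v) - x = (s *\<^sub>R rvec (lattice_floor s x) - x) - s *\<^sub>R rvec v"
    by (simp add: vec_eq_iff algebra_simps)
  then have "norm (s *\<^sub>R rvec (lattice_floor s x - v) - x) \<le>
      norm (s *\<^sub>R rvec (lattice_floor s x) - x) + norm (s *\<^sub>R rvec v)"
    by (metis norm_triangle_ineq4)
  then show ?thesis using 1 assms by (simp add: distrib_left)
qed

lemma tendsto_lattice_floor:
  fixes x :: "real ^ 'n::finite"
  shows "((\<lambda>s. s *\<^sub>R rvec (lattice_floor s x - v)) \<longlongrightarrow> x) (at_right 0)"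
proof (rule Lim_transform_bound[THEN Lim_null[THEN iffD2]])
  show "\<forall>\<^sub>F s in at_right 0. norm (s *\<^sub>R rvec (lattice_floor s x - v) - x) \<le>
      norm (s * (real CARD('n) + norm (rvec v)))"
    using eventually_at_right_less[of 0]
  proof eventually_elim
    case (elim s)
    show ?case
      using norm_lattice_floor[OF elim, of x v] by (metis abs_ge_self order_trans real_norm_def)
  qed
  show "((\<lambda>s. s * (real CARD('n) + norm (rvec v))) \<longlongrightarrow> 0) (at_right 0)"
    by (rule tendsto_mult_left_zero) (rule tendsto_ident_at)
qed

section \<open>Gaussian sums over shrinking lattices\<close>

definition gauss :: "real ^ 'n ^ 'n \<Rightarrow> real ^ 'n \<Rightarrow> real" where
  "gauss gi x = exp (- (x \<bullet> (gi *v x)))"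

lemma gauss_nonneg: "0 \<le> gauss gi x"
  by (simp add: gauss_def)

lemma borel_measurable_gauss [measurable]:
  "gauss gi \<in> borel_measurable (borel :: (real ^ 'n::finite) measure)"
  unfolding gauss_def by measurable

lemma isCont_gauss: "isCont (gauss gi) (x :: real ^ 'n::finite)"
  unfolding gauss_def
  by (intro continuous_intros linear_continuous_at matrix_vector_mul_bounded_linear)

text \<open>Let y be the sample point and c the coercivity constant. From |x| \<le> |y| + B follows
  |x|^2 \<le> 2 |y|^2 + 2 B^2, so exp(-c |y|^2) is at most exp(c B^2) exp(-c |x|^2 / 2). Half of the
  decay rate pays for the displacement, and \<open>w\<close> depends on s and v only through
  \<open>B\<close>.\<close>

lemma gauss_lattice_bound:
  fixes gi :: "real ^ 'n ^ 'n::finite"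
  assumes "constant_metric gi" and "0 \<le> B"
  obtains w where "integrable lborel w"
    "\<And>s v x. s > 0 \<Longrightarrow> s * (real CARD('n) + norm (rvec v)) \<le> B \<Longrightarrow>
        gauss gi (s *\<^sub>R rvec (lattice_floor s x - v)) \<le> w x"
proof -
  obtain c where c: "c > 0" "\<And>x. c * (norm x)\<^sup>2 \<le> x \<bullet> (gi *v x)"
    using metric_coercive[OF assms(1)] by blast
  define w where "w x = exp (c * B\<^sup>2) * exp (- (c / 2 * (norm x)\<^sup>2))" for x :: "real ^ 'n"
  have mat: "x \<bullet> (mat (c / 2) *v x) = c / 2 * (norm x)\<^sup>2" for x :: "real ^ 'n"
  proof -
    have "mat (c / 2) *v x = (c / 2) *\<^sub>R x"
      by (simp add: vec_eq_iff mat_def matrix_vector_mult_def if_distrib[of "\<lambda>c. c * _"] cong: if_cong)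
    then show ?thesis by (simp add: power2_norm_eq_inner)
  qed
  \<comment> \<open>Up to a constant factor, the majorant is the Gaussian of a multiple of the
    identity, so its integrability is an instance of the integral already computed.\<close>
  have "constant_metric (mat (c / 2) :: real ^ 'n ^ 'n)"
    unfolding constant_metric_def mat using c(1) by simp
  from gaussian_metric_integral[OF this] have "integrable lborel w"
    unfolding mat w_def by (intro integrable_mult_right) (simp add: has_bochner_integral_iff)
  moreover have "gauss gi (s *\<^sub>R rvec (lattice_floor s x - v)) \<le> w x"
    if "s > 0" "s * (real CARD('n) + norm (rvec v)) \<le> B" for s v x
  proof -
    let ?y = "s *\<^sub>R rvec (lattice_floor s x - v)"
    have d: "norm (?y - x) \<le> B"
      using norm_lattice_floor[OF that(1), of x v] that(2) by linarith
    have "norm x \<le> norm ?y + B"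
      using norm_triangle_ineq2[of x ?y] d by (simp add: norm_minus_commute)
    then have "(norm x)\<^sup>2 \<le> (norm ?y + B)\<^sup>2"
      by (intro power_mono) auto
    also have "\<dots> \<le> 2 * (norm ?y)\<^sup>2 + 2 * B\<^sup>2"
      using zero_le_power2[of "norm ?y - B"] by (simp add: power2_eq_square algebra_simps)
    finally have "c / 2 * (norm x)\<^sup>2 \<le> c / 2 * (2 * (norm ?y)\<^sup>2 + 2 * B\<^sup>2)"
      using c(1) by (intro mult_left_mono) auto
    then have "- (?y \<bullet> (gi *v ?y)) \<le> c * B\<^sup>2 + - (c / 2 * (norm x)\<^sup>2)"
      using c(2)[of ?y] by (simp add: distrib_left)
    then show ?thesis
      by (simp add: gauss_def w_def flip: exp_add)
  qed
  ultimately show thesis by (rule that)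
qed

lemma gauss_lattice_summable:
  fixes gi :: "real ^ 'n ^ 'n::finite"
  assumes "constant_metric gi" and s: "s > 0"
  shows "(\<lambda>k. gauss gi (s *\<^sub>R rvec (k - v))) summable_on UNIV"
proof -
  have "0 \<le> s * (real CARD('n) + norm (rvec v))" using s by simp
  then obtain w where w: "integrable lborel w"
    and wb: "\<And>s' v' x. s' > 0 \<Longrightarrow> s' * (real CARD('n) + norm (rvec v')) \<le> s * (real CARD('n) + norm (rvec v)) \<Longrightarrow>
        gauss gi (s' *\<^sub>R rvec (lattice_floor s' x - v')) \<le> w x"
    by (rule gauss_lattice_bound[OF assms(1)]) blast
  have m: "(\<lambda>x. gauss gi (s *\<^sub>R rvec (lattice_floor s x - v))) \<in> borel_measurable lborel"
    using measurable_compose[OF measurable_lattice_floor[of s], of "\<lambda>k. gauss gi (s *\<^sub>R rvec (k - v))"] by simp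
  have "integrable lborel (\<lambda>x. gauss gi (s *\<^sub>R rvec (lattice_floor s x - v)))"
    by (rule Bochner_Integration.integrable_bound[OF w m])
      (use wb[OF s order_refl] in \<open>auto simp: gauss_nonneg intro!: AE_I2 intro: order_trans[OF _ abs_ge_self]\<close>)
  then show ?thesis by (rule summable_on_lattice[OF s])
qed

text \<open>For s < 1 one majorant with B = n + |v| serves both the lattice and its translate. Both
  sample the Gaussian at points converging to the same x, so the differences vanish pointwise and,
  dominated by 2 w, also in the normalized sum. The absolute values inside the sum are what
  summation by parts consumes.\<close>

lemma
  fixes gi :: "real ^ 'n ^ 'n::finite"
  assumes g: "constant_metric gi"
  shows gauss_lattice_sum_tendsto:
      "((\<lambda>s. s ^ CARD('n) * (\<Sum>\<^sub>\<infinity>k. gauss gi (s *\<^sub>R rvec k))) \<longlongrightarrow>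
        sqrt_g gi * pi powr (real CARD('n) / 2)) (at_right 0)"
    and gauss_lattice_sum_diff_tendsto:
      "((\<lambda>s. s ^ CARD('n) * (\<Sum>\<^sub>\<infinity>k. \<bar>gauss gi (s *\<^sub>R rvec (k - v)) - gauss gi (s *\<^sub>R rvec k)\<bar>))
        \<longlongrightarrow> 0) (at_right 0)"
proof -
  let ?B = "real CARD('n) + norm (rvec v)"
  obtain w where w: "integrable lborel w"
    and wb: "\<And>s v x. s > 0 \<Longrightarrow> s * (real CARD('n) + norm (rvec v)) \<le> ?B \<Longrightarrow>
        gauss gi (s *\<^sub>R rvec (lattice_floor s x - v)) \<le> w x"
    using gauss_lattice_bound[OF g, of ?B] by auto
  have ev: "eventually (\<lambda>s::real. 0 < s \<and> s < 1) (at_right 0)"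
    using eventually_at_right_real[of 0 1] by simp
  have b0: "gauss gi (s *\<^sub>R rvec (lattice_floor s x)) \<le> w x" if "0 < s" "s < 1" for s x
  proof -
    have "s * (real CARD('n) + norm (rvec (0 :: int ^ 'n))) \<le> 1 * ?B"
      using that by (intro mult_mono) (auto simp: vec_eq_iff zero_vec_def[symmetric])
    then show ?thesis using wb[of s 0 x] that by simp
  qed
  have bv: "gauss gi (s *\<^sub>R rvec (lattice_floor s x - v)) \<le> w x" if "0 < s" "s < 1" for s x
    using wb[of s v x] that mult_right_mono[of s 1 ?B] by simp
  have lim: "((\<lambda>s. gauss gi (s *\<^sub>R rvec (lattice_floor s x - u))) \<longlongrightarrow> gauss gi x) (at_right 0)" for x u
    by (rule isCont_tendsto_compose[OF isCont_gauss tendsto_lattice_floor])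
  have lim0: "((\<lambda>s. gauss gi (s *\<^sub>R rvec (lattice_floor s x))) \<longlongrightarrow> gauss gi x) (at_right 0)" for x
    using lim[of x 0] by simp
  have "((\<lambda>s. s ^ CARD('n) * (\<Sum>\<^sub>\<infinity>k. gauss gi (s *\<^sub>R rvec k))) \<longlongrightarrow> (\<integral>x. gauss gi x \<partial>lborel)) (at_right 0)"
  proof (rule lattice_sum_dominated_convergence[OF _ w])
    show "\<forall>\<^sub>F s in at_right 0. \<forall>x. \<bar>gauss gi (s *\<^sub>R rvec (lattice_floor s x))\<bar> \<le> w x"
      using ev by eventually_elim (use b0 in \<open>auto simp: gauss_nonneg\<close>)
  qed (use lim0 in auto)
  moreover have "(\<integral>x. gauss gi x \<partial>lborel) = sqrt_g gi * pi powr (real CARD('n) / 2)"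
    using gaussian_metric_integral[OF g] by (simp add: gauss_def has_bochner_integral_iff)
  ultimately show "((\<lambda>s. s ^ CARD('n) * (\<Sum>\<^sub>\<infinity>k. gauss gi (s *\<^sub>R rvec k))) \<longlongrightarrow>
    sqrt_g gi * pi powr (real CARD('n) / 2)) (at_right 0)" by simp
  have "((\<lambda>s. s ^ CARD('n) * (\<Sum>\<^sub>\<infinity>k. \<bar>gauss gi (s *\<^sub>R rvec (k - v)) - gauss gi (s *\<^sub>R rvec k)\<bar>))
        \<longlongrightarrow> (\<integral>x. 0 \<partial>(lborel :: (real ^ 'n) measure))) (at_right 0)"
  proof (rule lattice_sum_dominated_convergence)
    show "integrable lborel (\<lambda>x. w x + w x)" using w by simp
    show "\<forall>\<^sub>F s in at_right 0. \<forall>x. \<bar>\<bar>gauss gi (s *\<^sub>R rvec (lattice_floor s x - v)) -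
        gauss gi (s *\<^sub>R rvec (lattice_floor s x))\<bar>\<bar> \<le> w x + w x"
      using ev
    proof eventually_elim
      case (elim s)
      show ?case
      proof
        fix x
        show "\<bar>\<bar>gauss gi (s *\<^sub>R rvec (lattice_floor s x - v)) - gauss gi (s *\<^sub>R rvec (lattice_floor s x))\<bar>\<bar> \<le> w x + w x"
          using b0[of s x] bv[of s x] elim gauss_nonneg[of gi "s *\<^sub>R rvec (lattice_floor s x - v)"]
            gauss_nonneg[of gi "s *\<^sub>R rvec (lattice_floor s x)"] by linarith
      qed
    qed
    show "((\<lambda>s. \<bar>gauss gi (s *\<^sub>R rvec (lattice_floor s x - v)) - gauss gi (s *\<^sub>R rvec (lattice_floor s x))\<bar>) \<longlongrightarrow> 0) (at_right 0)" for x
      using tendsto_rabs[OF tendsto_diff[OF lim[of x v] lim0[of x]]] by simp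
  qed simp
  then show "((\<lambda>s. s ^ CARD('n) * (\<Sum>\<^sub>\<infinity>k. \<bar>gauss gi (s *\<^sub>R rvec (k - v)) - gauss gi (s *\<^sub>R rvec k)\<bar>))
        \<longlongrightarrow> 0) (at_right 0)" by simp
qed


section \<open>The heat trace\<close>

lemma laplacian_eigenvalue_eq: "laplacian_eigenvalue gi k = rvec k \<bullet> (gi *v rvec k)"
  by (simp add: laplacian_eigenvalue_def inner_vec_def matrix_vector_mult_def sum_distrib_left
      mult.assoc mult.commute mult.left_commute)

lemma exp_laplacian_eigenvalue:
  assumes "0 \<le> t"
  shows "exp (- t * laplacian_eigenvalue gi k) = gauss gi (sqrt t *\<^sub>R rvec k)"
  using assms by (simp add: laplacian_eigenvalue_eq gauss_def matrix_vector_mult_scaleR mult.assoc[symmetric])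

lemma gauss_le_1:
  assumes "constant_metric gi"
  shows "gauss gi x \<le> 1"
  using assms by (cases "x = 0") (auto simp: gauss_def constant_metric_def intro: less_imp_le)

lemma heat_op_gauss:
  assumes "0 \<le> t"
  shows "heat_op gi t \<xi> = (\<lambda>k. of_real (gauss gi (sqrt t *\<^sub>R rvec k)) * \<xi> k)"
  unfolding heat_op_def exp_laplacian_eigenvalue[OF assms] ..

lemma heat_op_nct_U:
  assumes "0 \<le> t"
  shows "heat_op gi t (nct_U k) = (\<lambda>j. of_real (gauss gi (sqrt t *\<^sub>R rvec k)) * nct_U k j)"
  by (auto simp: heat_op_gauss[OF assms] nct_U_def)

lemma bounded_op_heat_op:
  fixes gi :: "real ^ 'n ^ 'n::finite"
  assumes g: "constant_metric gi" and t: "0 \<le> t"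
  shows "bounded_op (heat_op gi t)"
proof -
  have le: "(cmod (heat_op gi t \<xi> k))\<^sup>2 \<le> (cmod (\<xi> k))\<^sup>2" for \<xi> :: "'n nct" and k
    using gauss_le_1[OF g, of "sqrt t *\<^sub>R rvec k"] gauss_nonneg[of gi "sqrt t *\<^sub>R rvec k"]
    by (intro power_mono) (auto simp: heat_op_gauss[OF t] norm_mult intro: mult_left_le_one_le)
  have mem: "heat_op gi t \<xi> \<in> H_tau" if "\<xi> \<in> H_tau" for \<xi> :: "'n nct"
    using that unfolding H_tau_def mem_Collect_eq
    by (rule summable_on_comparison_test[OF _ le]) auto
  have "H_norm (heat_op gi t \<xi>) \<le> 1 * H_norm \<xi>" if "\<xi> \<in> H_tau" for \<xi> :: "'n nct"
    unfolding H_norm_def mult_1 using that mem[OF that] le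
    by (intro real_sqrt_le_mono infsum_mono) (auto simp: H_tau_def)
  then show ?thesis
    unfolding bounded_op_def using mem by (auto simp: heat_op_def algebra_simps intro!: exI[of _ 1])
qed

text \<open>The semigroup property splits the heat operator into two halves at time t/2, each
  Hilbert-Schmidt because Gaussian lattice sums converge. The bounded operator \<open>A\<close> is
  absorbed into the left half.\<close>

lemma trace_class_heat_op:
  fixes gi :: "real ^ 'n ^ 'n::finite"
  assumes g: "constant_metric gi" and t: "0 < t" and A: "bounded_op A"
  shows "trace_class (A \<circ> heat_op gi t)"
  unfolding trace_class_def
proof (rule exI[of _ "A \<circ> heat_op gi (t / 2)"], rule exI[of _ "heat_op gi (t / 2)"], intro conjI ballI)
  let ?h = "heat_op gi (t / 2)" and ?E = "\<lambda>k. gauss gi (sqrt (t / 2) *\<^sub>R rvec k)"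
  have t2: "0 \<le> t / 2" using t by simp
  have h: "bounded_op ?h" by (rule bounded_op_heat_op[OF g t2])
  obtain C where C: "\<And>\<xi>. \<xi> \<in> H_tau \<Longrightarrow> H_norm (A \<xi>) \<le> C * H_norm \<xi>"
    using A unfolding bounded_op_def by blast
  have hU: "H_norm (?h (nct_U k)) = ?E k" for k
    unfolding heat_op_nct_U[OF t2] H_norm_scale by (simp add: H_norm_nct_U gauss_nonneg)
  have sq: "(?E k)\<^sup>2 \<le> ?E k" for k
    unfolding power2_eq_square by (rule mult_left_le[OF gauss_le_1[OF g] gauss_nonneg])
  have sE: "(\<lambda>k. ?E k) summable_on UNIV"
    using gauss_lattice_summable[OF g, of "sqrt (t / 2)" 0] t by simp
  have s: "(\<lambda>k. (?E k)\<^sup>2) summable_on UNIV"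
    by (rule summable_on_comparison_test[OF sE sq]) auto
  then show "hilbert_schmidt ?h"
    unfolding hilbert_schmidt_def using h by (simp add: hU)
  show "hilbert_schmidt (A \<circ> ?h)"
    unfolding hilbert_schmidt_def
  proof
    show "bounded_op (A \<circ> ?h)" by (rule bounded_op_comp[OF A h])
    show "(\<lambda>k. (H_norm ((A \<circ> ?h) (nct_U k)))\<^sup>2) summable_on UNIV"
    proof (rule summable_on_comparison_test[OF summable_on_cmult_right[OF s, of "C\<^sup>2"]])
      fix k
      have "?h (nct_U k) \<in> H_tau"
        using h nct_U_in_H_tau unfolding bounded_op_def by blast
      from C[OF this] have "H_norm ((A \<circ> ?h) (nct_U k)) \<le> C * ?E k"
        by (simp add: hU)
      then have "(H_norm ((A \<circ> ?h) (nct_U k)))\<^sup>2 \<le> (C * ?E k)\<^sup>2"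
        by (intro power_mono H_norm_nonneg)
      then show "(H_norm ((A \<circ> ?h) (nct_U k)))\<^sup>2 \<le> C\<^sup>2 * (?E k)\<^sup>2"
        by (simp add: power_mult_distrib)
    qed auto
  qed
  have "heat_op gi t \<xi> = ?h (?h \<xi>)" for \<xi>
    by (simp add: heat_op_def fun_eq_iff mult.assoc[symmetric] exp_add[symmetric] flip: of_real_mult)
  then show "(A \<circ> heat_op gi t) \<xi> = (A \<circ> ?h) (?h \<xi>)" for \<xi> by simp
qed

section \<open>Phases and diagonal entries\<close>

definition lattice_character :: "real ^ 'n \<Rightarrow> int ^ 'n::finite \<Rightarrow> complex" where
  "lattice_character x k = exp (\<i> * of_real (rvec k \<bullet> x))"

lemma norm_lattice_character: "cmod (lattice_character x k) = 1"
  by (simp add: lattice_character_def norm_exp_eq_Re)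

lemma rvec_diff: "rvec (k - p) = rvec k - rvec p" and rvec_minus: "rvec (- p) = - rvec p"
  by (simp_all add: vec_eq_iff)

text \<open>Skewness gives p.Theta k = - k.Theta p and p.Theta p = 0, so each factor contributes the
  phase k.Theta p / 2 and the two halves add up.\<close>

lemma nct_cocycle_character:
  fixes \<Theta> :: "real ^ 'n ^ 'n::finite"
  assumes "transpose \<Theta> = - \<Theta>"
  shows "nct_cocycle \<Theta> k (- p) * nct_cocycle \<Theta> p (k - p) = lattice_character (\<Theta> *v rvec p) k"
proof -
  have neg: "\<Theta> *v (- x) = - (\<Theta> *v x)" for x
    by (rule linear_neg) simp
  have "rvec p \<bullet> (\<Theta> *v rvec k) = (transpose \<Theta> *v rvec p) \<bullet> rvec k"
    by (simp add: dot_lmul_matrix transpose_matrix_vector)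
  also have "\<dots> = - (rvec k \<bullet> (\<Theta> *v rvec p))"
    unfolding assms
    by (simp add: inner_vec_def matrix_vector_mult_def sum_negf mult.commute)
  finally have "rvec p \<bullet> (\<Theta> *v rvec k) = - (rvec k \<bullet> (\<Theta> *v rvec p))" .
  then show ?thesis
    unfolding nct_cocycle_def lattice_character_def rvec_diff rvec_minus neg
      matrix_vector_mult_diff_distrib inner_diff_right skew_form_self[OF assms]
    by (simp add: exp_add[symmetric])
qed

text \<open>Right multiplication sends U_k to a family whose entry at j contains r(j - k). Reading
  the product with \<open>l\<close> at k forces j = k - p, so \<open>r\<close> is evaluated at -p
  and the two cocycles are those combined into a character.\<close>

lemma diagonal_entry:
  fixes \<Theta> :: "real ^ 'n ^ 'n::finite"
  assumes \<Theta>: "transpose \<Theta> = - \<Theta>" and t: "0 \<le> t"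
  shows "((L_rep \<Theta> l \<circ> R_rep \<Theta> r) \<circ> heat_op gi t) (nct_U k) k =
    (\<Sum>\<^sub>\<infinity>p. l p * r (- p) * (of_real (gauss gi (sqrt t *\<^sub>R rvec k)) * lattice_character (\<Theta> *v rvec p) k))"
proof -
  let ?E = "of_real (gauss gi (sqrt t *\<^sub>R rvec k)) :: complex"
  have R: "R_rep \<Theta> r (heat_op gi t (nct_U k)) j = ?E * r (j - k) * nct_cocycle \<Theta> k (j - k)" for j
  proof -
    have "R_rep \<Theta> r (heat_op gi t (nct_U k)) j =
        (\<Sum>\<^sub>\<infinity>p\<in>{k}. ?E * nct_U k p * r (j - p) * nct_cocycle \<Theta> p (j - p))"
      unfolding R_rep_def nct_mult_def heat_op_nct_U[OF t]
      by (rule infsum_cong_neutral) (auto simp: nct_U_def)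
    then show ?thesis by (simp add: nct_U_def)
  qed
  show ?thesis
    unfolding comp_def L_rep_def nct_mult_def R
    by (rule infsum_cong) (simp add: nct_cocycle_character[OF \<Theta>, symmetric] mult.assoc mult.commute mult.left_commute)
qed

text \<open>The modulus of the (k, p) term is a product of a summable family in p and a summable
  family in k, so the double sum converges absolutely and its order can be exchanged.\<close>

lemma op_trace_heat_op:
  fixes \<Theta> gi :: "real ^ 'n ^ 'n::finite"
  assumes \<Theta>: "transpose \<Theta> = - \<Theta>" and g: "constant_metric gi" and t: "0 < t"
    and lr: "(\<lambda>p. cmod (l p * r (- p))) summable_on UNIV"
  shows "op_trace ((L_rep \<Theta> l \<circ> R_rep \<Theta> r) \<circ> heat_op gi t) =
    (\<Sum>\<^sub>\<infinity>p. l p * r (- p) *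
      (\<Sum>\<^sub>\<infinity>k. of_real (gauss gi (sqrt t *\<^sub>R rvec k)) * lattice_character (\<Theta> *v rvec p) k))"
proof -
  let ?E = "\<lambda>k. gauss gi (sqrt t *\<^sub>R rvec k)"
  let ?F = "\<lambda>k p. l p * r (- p) * (of_real (?E k) * lattice_character (\<Theta> *v rvec p) k)"
  have sE: "?E summable_on UNIV"
    using gauss_lattice_summable[OF g, of "sqrt t" 0] t by simp
  have nF: "norm (?F k p) = cmod (l p * r (- p)) * ?E k" for k p
    by (simp add: norm_mult norm_lattice_character gauss_nonneg)
  have "(\<lambda>(k, p). ?F k p) summable_on UNIV \<times> UNIV"
  proof (rule abs_summable_summable, subst Infinite_Sum.abs_summable_on_Sigma_iff, intro conjI ballI)
    show "(\<lambda>p. norm (case (k, p) of (k, p) \<Rightarrow> ?F k p)) summable_on UNIV" for k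
      using summable_on_cmult_left[OF lr, of "?E k"] by (simp only: prod.case nF)
    have "(\<Sum>\<^sub>\<infinity>p. norm (case (k, p) of (k, p) \<Rightarrow> ?F k p)) = (\<Sum>\<^sub>\<infinity>p. cmod (l p * r (- p))) * ?E k" for k
      by (simp only: prod.case nF infsum_cmult_left')
    moreover have "0 \<le> (\<Sum>\<^sub>\<infinity>p. cmod (l p * r (- p))) * ?E k" for k
      by (intro mult_nonneg_nonneg infsum_nonneg gauss_nonneg) auto
    ultimately show "(\<lambda>k. norm (\<Sum>\<^sub>\<infinity>p. norm (case (k, p) of (k, p) \<Rightarrow> ?F k p))) summable_on UNIV"
      using summable_on_cmult_right[OF sE, of "\<Sum>\<^sub>\<infinity>p. cmod (l p * r (- p))"] by simp
  qed
  then have "(\<Sum>\<^sub>\<infinity>k. \<Sum>\<^sub>\<infinity>p. ?F k p) = (\<Sum>\<^sub>\<infinity>p. \<Sum>\<^sub>\<infinity>k. ?F k p)"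
    by (rule infsum_swap_banach)
  then show ?thesis
    using t by (simp add: op_trace_def H_inner_nct_U diagonal_entry[OF \<Theta>] infsum_cmult_right' del: o_apply)
qed

section \<open>Limits of Gaussian sums twisted by a character\<close>

lemma character_sum_norm_le:
  fixes gi :: "real ^ 'n ^ 'n::finite"
  assumes g: "constant_metric gi" and s: "0 < s"
  shows "cmod (\<Sum>\<^sub>\<infinity>k. of_real (gauss gi (s *\<^sub>R rvec k)) * lattice_character x k) \<le>
    (\<Sum>\<^sub>\<infinity>k. gauss gi (s *\<^sub>R rvec k))"
proof (rule norm_infsum_le)
  have sE: "(\<lambda>k. gauss gi (s *\<^sub>R rvec k)) summable_on UNIV"
    using gauss_lattice_summable[OF g s, of 0] by simp
  then show "((\<lambda>k. gauss gi (s *\<^sub>R rvec k)) has_sum (\<Sum>\<^sub>\<infinity>k. gauss gi (s *\<^sub>R rvec k))) UNIV"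
    by simp
  have n: "norm (of_real (gauss gi (s *\<^sub>R rvec k)) * lattice_character x k) = gauss gi (s *\<^sub>R rvec k)" for k
    by (simp add: norm_mult norm_lattice_character gauss_nonneg)
  then show "norm (of_real (gauss gi (s *\<^sub>R rvec k)) * lattice_character x k) \<le> gauss gi (s *\<^sub>R rvec k)" for k
    by simp
  have "(\<lambda>k. norm (of_real (gauss gi (s *\<^sub>R rvec k)) * lattice_character x k)) summable_on UNIV"
    unfolding n by (rule sE)
  then show "((\<lambda>k. of_real (gauss gi (s *\<^sub>R rvec k)) * lattice_character x k) has_sum
      (\<Sum>\<^sub>\<infinity>k. of_real (gauss gi (s *\<^sub>R rvec k)) * lattice_character x k)) UNIV"
    by (rule has_sum_infsum[OF abs_summable_summable])
qed

text \<open>Summation by parts: translating the lattice by the \<open>\<mu>\<close>-th unit vector multiplies the character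
  by \<open>exp (\<i> x\<^sub>\<mu>) \<noteq> 1\<close> but changes the Gaussian only by a lower-order term.\<close>

lemma character_sum_tendsto_0:
  fixes gi :: "real ^ 'n ^ 'n::finite"
  assumes g: "constant_metric gi" and x: "x $ \<mu> / (2 * pi) \<notin> \<int>"
  shows "((\<lambda>s. of_real (s ^ CARD('n)) * (\<Sum>\<^sub>\<infinity>k. of_real (gauss gi (s *\<^sub>R rvec k)) * lattice_character x k))
    \<longlongrightarrow> 0) (at_right 0)"
proof -
  define v :: "int ^ 'n" where "v = axis \<mu> 1"
  define z where "z = exp (\<i> * of_real (x $ \<mu>))"
  have z1: "z \<noteq> 1"
  proof
    assume "z = 1"
    then obtain m :: int where "x $ \<mu> = of_int (2 * m) * pi"
      by (auto simp: z_def exp_eq_1)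
    then have "x $ \<mu> / (2 * pi) = of_int m" by simp
    then show False using x by simp
  qed
  have v: "rvec v = axis \<mu> 1" by (simp add: vec_eq_iff v_def axis_def)
  have kv: "rvec (k - v) \<bullet> x = rvec k \<bullet> x - x $ \<mu>" for k
    unfolding rvec_diff v by (simp add: inner_diff_left inner_axis')
  have shift: "z * lattice_character x (k - v) = lattice_character x k" for k
    unfolding lattice_character_def z_def kv by (simp add: algebra_simps flip: exp_add)
  let ?S = "\<lambda>s. \<Sum>\<^sub>\<infinity>k. of_real (gauss gi (s *\<^sub>R rvec k)) * lattice_character x k"
  let ?D = "\<lambda>s. \<Sum>\<^sub>\<infinity>k. \<bar>gauss gi (s *\<^sub>R rvec (k - v)) - gauss gi (s *\<^sub>R rvec k)\<bar>"
  \<comment> \<open>Write E for the Gaussian weight and X for the character. Since z X(k - v) =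
    X(k), translating the index gives (z - 1) S = sum of (E(k - v) - E(k)) X(k); taking moduli then
    removes X.\<close>
  have main: "cmod (z - 1) * cmod (?S s) \<le> ?D s" if s: "s > 0" for s
  proof -
    let ?f = "\<lambda>u k. of_real (gauss gi (s *\<^sub>R rvec (k - u))) * lattice_character x k"
    have sr: "(\<lambda>k. gauss gi (s *\<^sub>R rvec (k - u))) summable_on UNIV" for u
      by (rule gauss_lattice_summable[OF g s])
    have sf: "?f u summable_on UNIV" for u
      by (rule abs_summable_summable)
        (use sr[of u] in \<open>simp add: norm_mult norm_lattice_character gauss_nonneg\<close>)
    have bij: "bij_betw (\<lambda>k. k - v) UNIV (UNIV :: (int ^ 'n) set)"
      by (rule bij_betwI[where g = "\<lambda>k. k + v"]) auto
    have "?S s = (\<Sum>\<^sub>\<infinity>k. of_real (gauss gi (s *\<^sub>R rvec (k - v))) * lattice_character x (k - v))"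
      using infsum_reindex_bij_betw[OF bij, of "\<lambda>k. of_real (gauss gi (s *\<^sub>R rvec k)) * lattice_character x k"]
      by simp
    then have "z * ?S s = infsum (?f v) UNIV"
      by (simp only: infsum_cmult_right'[symmetric] mult.left_commute[of z] shift)
    moreover have "?S s = infsum (?f 0) UNIV" by (simp only: diff_zero)
    ultimately have "(z - 1) * ?S s = (\<Sum>\<^sub>\<infinity>k. ?f v k - ?f 0 k)"
      by (simp only: infsum_diff[OF sf sf] left_diff_distrib mult_1)
    moreover have "cmod (\<Sum>\<^sub>\<infinity>k. ?f v k - ?f 0 k) \<le> ?D s"
    proof (rule norm_infsum_le[OF has_sum_infsum has_sum_infsum])
      show "(\<lambda>k. ?f v k - ?f 0 k) summable_on UNIV"
        by (rule summable_on_diff[OF sf sf])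
      have "(\<lambda>k. gauss gi (s *\<^sub>R rvec (k - v)) - gauss gi (s *\<^sub>R rvec k)) summable_on UNIV"
        using summable_on_diff[OF sr[of v] sr[of 0]] by (simp only: diff_zero)
      then show "(\<lambda>k. \<bar>gauss gi (s *\<^sub>R rvec (k - v)) - gauss gi (s *\<^sub>R rvec k)\<bar>) summable_on UNIV"
        by (rule summable_on_iff_abs_summable_on_real[THEN iffD1, unfolded real_norm_def])
      have "?f v k - ?f 0 k = of_real (gauss gi (s *\<^sub>R rvec (k - v)) - gauss gi (s *\<^sub>R rvec k)) *
          lattice_character x k" for k
        by (simp only: diff_zero of_real_diff left_diff_distrib)
      then show "cmod (?f v k - ?f 0 k) \<le> \<bar>gauss gi (s *\<^sub>R rvec (k - v)) - gauss gi (s *\<^sub>R rvec k)\<bar>" for k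
        by (simp only: norm_mult norm_lattice_character norm_of_real mult_1_right order_refl)
    qed
    ultimately show ?thesis by (simp only: flip: norm_mult)
  qed
  show ?thesis
  proof (rule Lim_null_comparison)
    show "((\<lambda>s. (s ^ CARD('n) * ?D s) / cmod (z - 1)) \<longlongrightarrow> 0) (at_right 0)"
      using tendsto_divide[OF gauss_lattice_sum_diff_tendsto[OF g, of v] tendsto_const, of "cmod (z - 1)"] z1
      by simp
    show "\<forall>\<^sub>F s in at_right 0. norm (of_real (s ^ CARD('n)) * ?S s) \<le> (s ^ CARD('n) * ?D s) / cmod (z - 1)"
      using eventually_at_right_less[of 0]
    proof eventually_elim
      case (elim s)
      have "cmod (?S s) \<le> ?D s / cmod (z - 1)"
        using main[OF elim] z1 by (simp add: field_simps)
      then show ?case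
        using elim mult_left_mono[of "cmod (?S s)" "?D s / cmod (z - 1)" "s ^ CARD('n)"]
        by (simp add: norm_mult norm_power)
    qed
  qed
qed

lemma character_sum_tendsto:
  fixes \<Theta> gi :: "real ^ 'n ^ 'n::finite"
  assumes g: "constant_metric gi"
  shows "((\<lambda>s. of_real (s ^ CARD('n)) *
      (\<Sum>\<^sub>\<infinity>k. of_real (gauss gi (s *\<^sub>R rvec k)) * lattice_character (\<Theta> *v rvec p) k))
    \<longlongrightarrow> (if p \<in> Z_set \<Theta> then of_real (sqrt_g gi * pi powr (real CARD('n) / 2)) else 0)) (at_right 0)"
proof (cases "p \<in> Z_set \<Theta>")
  case True
  then obtain m where m: "(1 / (2 * pi)) *\<^sub>R (\<Theta> *v rvec p) = rvec m"
    by (auto simp: Z_set_def)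
  have "\<Theta> *v rvec p = (2 * pi) *\<^sub>R ((1 / (2 * pi)) *\<^sub>R (\<Theta> *v rvec p))"
    by simp
  then have eq: "\<Theta> *v rvec p = (2 * pi) *\<^sub>R rvec m"
    by (simp only: m)
  have "lattice_character (\<Theta> *v rvec p) k = 1" for k
  proof -
    have "rvec k \<bullet> (\<Theta> *v rvec p) = of_int (2 * (\<Sum>i\<in>UNIV. k $ i * m $ i)) * pi"
      unfolding eq by (simp add: inner_vec_def sum_distrib_left sum_distrib_right mult_ac)
    then show ?thesis
      unfolding lattice_character_def exp_eq_1
      by (auto intro!: exI[of _ "\<Sum>i\<in>UNIV. k $ i * m $ i"])
  qed
  then have sum_eq: "(\<Sum>\<^sub>\<infinity>k. of_real (gauss gi (s *\<^sub>R rvec k)) * lattice_character (\<Theta> *v rvec p) k) =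
      of_real (\<Sum>\<^sub>\<infinity>k. gauss gi (s *\<^sub>R rvec k))" if "s > 0" for s
    using infsumI[OF has_sum_of_real[OF has_sum_infsum[OF gauss_lattice_summable[OF g that, of 0]]]]
    by simp
  have "\<forall>\<^sub>F s in at_right 0. of_real (s ^ CARD('n) * (\<Sum>\<^sub>\<infinity>k. gauss gi (s *\<^sub>R rvec k))) =
      of_real (s ^ CARD('n)) *
        (\<Sum>\<^sub>\<infinity>k. of_real (gauss gi (s *\<^sub>R rvec k)) * lattice_character (\<Theta> *v rvec p) k)"
    using eventually_at_right_less[of 0] by eventually_elim (simp add: sum_eq)
  from Lim_transform_eventually[OF tendsto_of_real[OF gauss_lattice_sum_tendsto[OF g]] this]
  show ?thesis using True by simp
next
  case False
  \<comment> \<open>Failure to lie in \<open>Z_set \<Theta>\<close> is failure in some coordinate,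
    and that coordinate is the direction of summation by parts.\<close>
  have "\<exists>\<mu>. (\<Theta> *v rvec p) $ \<mu> / (2 * pi) \<notin> \<int>"
  proof (rule ccontr)
    assume "\<nexists>\<mu>. (\<Theta> *v rvec p) $ \<mu> / (2 * pi) \<notin> \<int>"
    then have "\<forall>\<mu>. \<exists>m. (\<Theta> *v rvec p) $ \<mu> / (2 * pi) = of_int m"
      by (auto elim: Ints_cases)
    then obtain m where "\<And>\<mu>. (\<Theta> *v rvec p) $ \<mu> / (2 * pi) = of_int (m \<mu>)"
      by metis
    then have "(1 / (2 * pi)) *\<^sub>R (\<Theta> *v rvec p) = rvec (\<chi> \<mu>. m \<mu>)"
      by (simp add: vec_eq_iff)
    then have "p \<in> Z_set \<Theta>"
      unfolding Z_set_def mem_Collect_eq by (rule exI)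
    then show False using False by contradiction
  qed
  then show ?thesis
    using False character_sum_tendsto_0[OF g] by auto
qed

theorem theorem2p3:
  fixes \<Theta> gi :: "real ^ 'n ^ 'n::finite"
    and e :: "nat \<Rightarrow> 'n" and l\<^sub>0 :: nat and rs irs :: "real list"
    and l r :: "'n nct"
  assumes "transpose \<Theta> = - \<Theta>"
    and "block_normal_form e l\<^sub>0 rs irs \<Theta>"
    and "diophantine e (2 * length irs) \<Theta>"
    and "constant_metric gi"
    and "l \<in> nct_smooth" and "r \<in> nct_smooth"
  shows "has_Sp gi (L_rep \<Theta> l \<circ> R_rep \<Theta> r)
           (of_real (sqrt_g gi) * (\<Sum>\<^sub>\<infinity>q\<in>Z_set \<Theta>. nct_coeff l q * nct_coeff r (- q)))"
proof -
  note \<Theta> = assms(1) and g = assms(4)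
  have l: "(\<lambda>p. cmod (l p)) summable_on UNIV" and r: "(\<lambda>p. cmod (r p)) summable_on UNIV"
    using assms by (auto intro: nct_smooth_summable)
  have bdd: "bounded_op (L_rep \<Theta> l \<circ> R_rep \<Theta> r)"
    by (intro bounded_op_comp bounded_op_L_rep bounded_op_R_rep l r)
  \<comment> \<open>A summable family is bounded by its l1 norm, so l(p) r(-p) is dominated by a
    multiple of |l(p)|.\<close>
  have "cmod (r q) \<le> (\<Sum>\<^sub>\<infinity>p. cmod (r p))" for q
    using finite_sum_le_infsum[OF r, of "{q}"] by simp
  then have lr: "(\<lambda>p. cmod (l p * r (- p))) summable_on UNIV"
    by (intro summable_on_comparison_test[OF summable_on_cmult_left[OF l, of "\<Sum>\<^sub>\<infinity>p. cmod (r p)"]])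
      (auto simp: norm_mult intro!: mult_left_mono)
  define n where "n = real CARD('n)"
  define S where "S t p = (\<Sum>\<^sub>\<infinity>k. of_real (gauss gi (sqrt t *\<^sub>R rvec k)) * lattice_character (\<Theta> *v rvec p) k)" for t p
  define c where "c t = (4 * pi * t) powr (n / 2)" for t
  define W where "W p = (if p \<in> Z_set \<Theta> then of_real ((2 * pi) powr n * sqrt_g gi) else 0 :: complex)" for p
  \<comment> \<open>The Gaussian limits are stated in the lattice spacing s = sqrt t; this
    transports them to t.\<close>
  have sqrt0: "filterlim sqrt (at_right 0) (at_right 0)"
    unfolding filterlim_at
    using tendsto_real_sqrt[OF tendsto_ident_at[of 0 "{0<..}"]] eventually_at_right_less[of 0]
    by (auto elim: eventually_mono)
  have c_eq: "c t = (4 * pi) powr (n / 2) * sqrt t ^ CARD('n)" if "t > 0" for t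
  proof -
    have "t powr (n / 2) = sqrt t ^ CARD('n)"
      using that by (simp add: n_def powr_half_sqrt[symmetric] powr_powr flip: powr_realpow)
    then show ?thesis using that by (simp add: c_def powr_mult)
  qed
  \<comment> \<open>The first factor is the heat normalization without its power of t, the second
    the Gaussian integral without sqrt g.\<close>
  have const: "(4 * pi) powr (n / 2) * pi powr (n / 2) = (2 * pi) powr n"
  proof -
    have "(4 * pi) powr (n / 2) * pi powr (n / 2) = ((2 * pi) powr 2) powr (n / 2)"
      by (simp add: powr_mult[symmetric] power2_eq_square mult.assoc)
    then show ?thesis by (simp only: powr_powr) simp
  qed
  have lim: "((\<lambda>t. of_real (c t) * S t p) \<longlongrightarrow> W p) (at_right 0)" for p
  proof -
    let ?V = "if p \<in> Z_set \<Theta> then of_real (sqrt_g gi * pi powr (n / 2)) else 0 :: complex"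
    have "((\<lambda>t. of_real ((4 * pi) powr (n / 2)) * (of_real (sqrt t ^ CARD('n)) * S t p)) \<longlongrightarrow>
        of_real ((4 * pi) powr (n / 2)) * ?V) (at_right 0)"
      unfolding S_def n_def
      by (intro tendsto_mult_left filterlim_compose[OF character_sum_tendsto[OF g] sqrt0])
    also have "of_real ((4 * pi) powr (n / 2)) * ?V = W p"
    proof -
      have "(4 * pi) powr (n / 2) * (sqrt_g gi * pi powr (n / 2)) = (2 * pi) powr n * sqrt_g gi"
        unfolding const[symmetric] by (simp only: mult_ac)
      then have "complex_of_real ((4 * pi) powr (n / 2)) * of_real (sqrt_g gi * pi powr (n / 2)) =
          of_real ((2 * pi) powr n * sqrt_g gi)"
        by (metis of_real_mult)
      then show ?thesis
        by (cases "p \<in> Z_set \<Theta>") (simp_all only: W_def if_True if_False mult_zero_right)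
    qed
    finally show ?thesis
    proof (rule Lim_transform_eventually)
      show "\<forall>\<^sub>F t in at_right 0. of_real ((4 * pi) powr (n / 2)) * (of_real (sqrt t ^ CARD('n)) * S t p)
        = of_real (c t) * S t p"
        using eventually_at_right_less[of 0] by eventually_elim (simp add: c_eq mult.assoc)
    qed
  qed
  \<comment> \<open>\<open>M\<close> must be independent of p. The modulus is at most that of the
    untwisted sum, which converges and so stays below its limit plus 1 for small t.\<close>
  obtain M where M: "\<forall>\<^sub>F t in at_right 0. \<forall>p. cmod (of_real (c t) * S t p) \<le> M"
  proof -
    let ?G = "\<lambda>s. s ^ CARD('n) * (\<Sum>\<^sub>\<infinity>k. gauss gi (s *\<^sub>R rvec k))"
    let ?lim = "sqrt_g gi * pi powr (real CARD('n) / 2)"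
    have "((\<lambda>t. ?G (sqrt t)) \<longlongrightarrow> ?lim) (at_right 0)"
      by (rule filterlim_compose[OF gauss_lattice_sum_tendsto[OF g] sqrt0])
    then have "\<forall>\<^sub>F t in at_right 0. ?G (sqrt t) < ?lim + 1"
      by (rule order_tendstoD) simp
    then have "\<forall>\<^sub>F t in at_right 0. \<forall>p. cmod (of_real (c t) * S t p) \<le> (4 * pi) powr (n / 2) * (?lim + 1)"
      using eventually_at_right_less[of 0]
    proof eventually_elim
      case (elim t)
      show ?case
      proof
        fix p
        have "cmod (S t p) \<le> (\<Sum>\<^sub>\<infinity>k. gauss gi (sqrt t *\<^sub>R rvec k))"
          unfolding S_def using elim by (intro character_sum_norm_le[OF g]) simp
        then have "c t * cmod (S t p) \<le> c t * (\<Sum>\<^sub>\<infinity>k. gauss gi (sqrt t *\<^sub>R rvec k))"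
          by (intro mult_left_mono) (simp_all add: c_def)
        also have "\<dots> = (4 * pi) powr (n / 2) * ?G (sqrt t)"
          using elim by (simp add: c_eq)
        also have "\<dots> \<le> (4 * pi) powr (n / 2) * (?lim + 1)"
          using elim by (intro mult_left_mono) auto
        finally show "cmod (of_real (c t) * S t p) \<le> (4 * pi) powr (n / 2) * (?lim + 1)"
          by (simp add: norm_mult c_def)
      qed
    qed
    then show thesis by (rule that)
  qed
  have sum_lim: "((\<lambda>t. \<Sum>\<^sub>\<infinity>p. l p * r (- p) * (of_real (c t) * S t p)) \<longlongrightarrow> (\<Sum>\<^sub>\<infinity>p. l p * r (- p) * W p)) (at_right 0)"
  proof (rule tendsto_infsum_dominated)
    show "(\<lambda>p. cmod (l p * r (- p)) * M) summable_on UNIV"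
      by (rule summable_on_cmult_left[OF lr])
    show "\<forall>\<^sub>F t in at_right 0. \<forall>p\<in>UNIV. norm (l p * r (- p) * (of_real (c t) * S t p)) \<le> cmod (l p * r (- p)) * M"
      using M by eventually_elim (auto simp only: norm_mult[of "_ * _" "_ * _"] intro!: mult_left_mono norm_ge_zero)
  qed (intro tendsto_mult_left lim)
  have value_eq: "(\<Sum>\<^sub>\<infinity>p. l p * r (- p) * W p) =
      of_real (sqrt_g gi) * (\<Sum>\<^sub>\<infinity>q\<in>Z_set \<Theta>. nct_coeff l q * nct_coeff r (- q))"
  proof -
    \<comment> \<open>The factor (2 pi)^n is shared equally between \<open>nct_coeff l q\<close> and
      \<open>nct_coeff r (- q)\<close>; the vanishing of \<open>W\<close> off
      \<open>Z_set \<Theta>\<close> restricts the sum.\<close>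
    have "(2 * pi) powr n = (2 * pi) powr (n / 2) * (2 * pi) powr (n / 2)"
      by (simp flip: powr_add)
    then have "(\<Sum>\<^sub>\<infinity>p. l p * r (- p) * W p) =
        (\<Sum>\<^sub>\<infinity>q\<in>Z_set \<Theta>. of_real (sqrt_g gi) * (nct_coeff l q * nct_coeff r (- q)))"
      by (intro infsum_cong_neutral) (auto simp: W_def nct_coeff_def n_def)
    then show ?thesis by (simp add: infsum_cmult_right')
  qed
  have trace_eq: "\<forall>\<^sub>F t in at_right 0. (\<Sum>\<^sub>\<infinity>p. l p * r (- p) * (of_real (c t) * S t p)) =
      of_real ((4 * pi * t) powr (real CARD('n) / 2)) * op_trace ((L_rep \<Theta> l \<circ> R_rep \<Theta> r) \<circ> heat_op gi t)"
    using eventually_at_right_less[of 0]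
  proof eventually_elim
    case (elim t)
    have "(\<Sum>\<^sub>\<infinity>p. l p * r (- p) * (of_real (c t) * S t p)) = of_real (c t) * (\<Sum>\<^sub>\<infinity>p. l p * r (- p) * S t p)"
      by (simp only: mult.left_commute[of _ "of_real (c t)"] infsum_cmult_right')
    then show ?case
      unfolding op_trace_heat_op[OF \<Theta> g elim lr] S_def c_def n_def .
  qed
  have "((\<lambda>t. of_real ((4 * pi * t) powr (real CARD('n) / 2)) *
      op_trace ((L_rep \<Theta> l \<circ> R_rep \<Theta> r) \<circ> heat_op gi t)) \<longlongrightarrow>
      of_real (sqrt_g gi) * (\<Sum>\<^sub>\<infinity>q\<in>Z_set \<Theta>. nct_coeff l q * nct_coeff r (- q))) (at_right 0)"
    using Lim_transform_eventually[OF sum_lim trace_eq] unfolding value_eq .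
  then show ?thesis
    unfolding has_Sp_def using bdd trace_class_heat_op[OF g _ bdd] by blast
qed

end
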